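(* ${}^1\mathsf{TT}^1_{\mathbb{N}} \leq_{\mathrm{W}} \mathsf{RT}^1_{\mathbb{N}}$.
   Context: A problem $\mathsf{P}$ is a partial multivalued function from $\omega^\omega$ to $\omega^\omega$ with nonempty solution sets $\mathsf{P}(x)$ on its domain (its instances); objects are coded in $\omega^\omega$ via standard codings, and Turing functionals are identified with their indices. $\mathsf{P} \leq_{\mathrm{W}} \mathsf{Q}$ means there are Turing functionals $\Phi,\Psi$ such that for every instance $x$ of $\mathsf{P}$, $\Phi(x)$ is an instance of $\mathsf{Q}$, and for every $\mathsf{Q}$-solution $y$ of $\Phi(x)$, $\Psi(x\oplus y)$ is a $\mathsf{P}$-solution of $x$. $\mathsf{RT}^1_{\mathbb{N}}$: instances are all $g:\omega\to\omega$ with finite range (no bound supplied), solutions all infinite $M\subseteq\omega$ on which $g$ is constant. $\mathsf{TT}^1_{\mathbb{N}}$: instances are all $f:2^{<\omega}\to\omega$ with finite range (no bound supplied), solutions all $H\subseteq 2^{<\omega}$ with $(H,\preceq)$ order-isomorphic to $(2^{<\omega},\preceq)$ ($\preceq$ the prefix order) and $f$ constant on $H$. The first-order part ${}^1\mathsf{P}$ of $\mathsf{P}$ is the problem whose instances are all triples $\langle A,\Delta,\Gamma\rangle$ with $A\in 2^\omega$ and $\Delta,\Gamma$ Turing functionals such that $\Delta(A)$ is an instance of $\mathsf{P}$ and $\Gamma(A\oplus y)(0)$ converges for every $y\in\mathsf{P}(\Delta(A))$; its solutions are all values $\Gamma(A\oplus y)(0)$ for $y\in\mathsf{P}(\Delta(A))$.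 *)

theory Defs
  imports "HOL-Library.Nat_Bijection" "HOL-Library.Sublist"
begin

section \<open>Turing functionals\<close>

text \<open>
  Turing functionals are given by Kleene's oracle version of the partial recursive functions.
  All programs are unary; several arguments are passed through the Cantor pairing
  \<^const>\<open>prod_encode\<close>. \<open>Query\<close> asks the oracle, \<open>Rec p q\<close> is primitive recursion and
  \<open>Min p\<close> is unbounded minimisation.
\<close>

datatype prog =
    Zero | Succ | Fst | Snd | Query
  | Tuple prog prog | Comp prog prog | Rec prog prog | Min prog

primrec run :: "prog \<Rightarrow> (nat \<Rightarrow> nat) \<Rightarrow> nat \<Rightarrow> nat option" where
  "run Zero X n = Some 0"
| "run Succ X n = Some (Suc n)"
| "run Fst X n = Some (fst (prod_decode n))"
| "run Snd X n = Some (snd (prod_decode n))"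
| "run Query X n = Some (X n)"
| "run (Tuple p q) X n =
     (case run p X n of None \<Rightarrow> None | Some a \<Rightarrow>
       (case run q X n of None \<Rightarrow> None | Some b \<Rightarrow> Some (prod_encode (a, b))))"
| "run (Comp p q) X n =
     (case run q X n of None \<Rightarrow> None | Some a \<Rightarrow> run p X a)"
| "run (Rec p q) X n =
     (case prod_decode n of (a, k) \<Rightarrow>
       rec_nat (run p X a)
         (\<lambda>i r. case r of None \<Rightarrow> None
                 | Some v \<Rightarrow> run q X (prod_encode (a, prod_encode (i, v)))) k)"
| "run (Min p) X n =
     (if \<exists>k. run p X (prod_encode (n, k)) = Some 0
           \<and> (\<forall>j<k. run p X (prod_encode (n, j)) \<noteq> None)
      then Some (LEAST k. run p X (prod_encode (n, k)) = Some 0)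
      else None)"

text \<open>An effective numbering of the programs in which every natural number is an index.\<close>

function prog_of :: "nat \<Rightarrow> prog" where
  "prog_of e =
     (if e = 0 then Zero else if e = 1 then Succ else if e = 2 then Fst
      else if e = 3 then Snd else if e = 4 then Query
      else let m = (e - 5) div 4; a = fst (prod_decode m); b = snd (prod_decode m) in
        if (e - 5) mod 4 = 0 then Tuple (prog_of a) (prog_of b)
        else if (e - 5) mod 4 = 1 then Comp (prog_of a) (prog_of b)
        else if (e - 5) mod 4 = 2 then Rec (prog_of a) (prog_of b)
        else Min (prog_of m))"
  by pat_completeness auto
termination
proof -
  have 1: "fst (prod_decode m) \<le> m" "snd (prod_decode m) \<le> m" for m
    by (metis le_prod_encode_1 le_prod_encode_2 prod.collapse prod_decode_inverse)+
  have 2: "(e - 5) div 4 < e" if "e \<noteq> 0" for e :: nat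
    using that by linarith
  show ?thesis
    by (relation "measure id") (auto intro: le_less_trans[OF 1(1) 2] le_less_trans[OF 1(2) 2])
qed

declare prog_of.simps [simp del]

lemma prog_of_eqs:
  "prog_of 0 = Zero" "prog_of 1 = Succ" "prog_of 2 = Fst" "prog_of 3 = Snd" "prog_of 4 = Query"
  "prog_of (5 + 4 * prod_encode (a, b)) = Tuple (prog_of a) (prog_of b)"
  "prog_of (6 + 4 * prod_encode (a, b)) = Comp (prog_of a) (prog_of b)"
  "prog_of (7 + 4 * prod_encode (a, b)) = Rec (prog_of a) (prog_of b)"
  "prog_of (8 + 4 * a) = Min (prog_of a)"
proof -
  show "prog_of 0 = Zero" "prog_of 1 = Succ" "prog_of 2 = Fst" "prog_of 3 = Snd"
    "prog_of 4 = Query"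
    by (simp_all add: prog_of.simps)
  define m where "m = prod_encode (a, b)"
  have m: "fst (prod_decode m) = a" "snd (prod_decode m) = b"
    by (simp_all add: m_def)
  have *: "5 + 4 * k - 5 = 4 * k" "6 + 4 * k - 5 = 4 * k + 1" "7 + 4 * k - 5 = 4 * k + 2"
    "8 + 4 * k - 5 = 4 * k + 3" for k :: nat
    by simp_all
  have **: "4 * k mod 4 = 0" "(4 * k + 1) mod 4 = 1" "(4 * k + 2) mod 4 = 2" "(4 * k + 3) mod 4 = 3"
    "4 * k div 4 = k" "(4 * k + 1) div 4 = k" "(4 * k + 2) div 4 = k" "(4 * k + 3) div 4 = k"
    for k :: nat
    by - presburger+
  show "prog_of (5 + 4 * prod_encode (a, b)) = Tuple (prog_of a) (prog_of b)"
    unfolding m_def[symmetric] prog_of.simps[of "5 + 4 * m"] Let_def * ** m by simp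
  show "prog_of (6 + 4 * prod_encode (a, b)) = Comp (prog_of a) (prog_of b)"
    unfolding m_def[symmetric] prog_of.simps[of "6 + 4 * m"] Let_def * ** m by simp
  show "prog_of (7 + 4 * prod_encode (a, b)) = Rec (prog_of a) (prog_of b)"
    unfolding m_def[symmetric] prog_of.simps[of "7 + 4 * m"] Let_def * ** m by simp
  show "prog_of (8 + 4 * a) = Min (prog_of a)"
    unfolding prog_of.simps[of "8 + 4 * a"] Let_def * ** by simp
qed

lemma surj_prog_of: "surj prog_of"
proof -
  have "\<exists>e. prog_of e = p" for p
    by (induction p) (metis prog_of_eqs)+
  then show ?thesis by (metis surjI)
qed

definition Phi :: "nat \<Rightarrow> (nat \<Rightarrow> nat) \<Rightarrow> nat \<Rightarrow> nat option" where
  "Phi e X n = run (prog_of e) X n"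

text \<open>\<open>computes e X Y\<close>: the functional with index \<open>e\<close> is total on oracle \<open>X\<close>, with value \<open>Y\<close>.\<close>

definition computes :: "nat \<Rightarrow> (nat \<Rightarrow> nat) \<Rightarrow> (nat \<Rightarrow> nat) \<Rightarrow> bool" where
  "computes e X Y \<longleftrightarrow> (\<forall>n. Phi e X n = Some (Y n))"

definition join :: "(nat \<Rightarrow> nat) \<Rightarrow> (nat \<Rightarrow> nat) \<Rightarrow> nat \<Rightarrow> nat" where
  "join X Y n = (if even n then X (n div 2) else Y (n div 2))"


section \<open>Problems and Weihrauch reducibility\<close>

text \<open>
  That every instance has a solution is recorded by \<open>well_posed\<close>; it is proved below for
  all problems considered here.
\<close>

record problem =
  instances :: "(nat \<Rightarrow> nat) set"
  solutions :: "(nat \<Rightarrow> nat) \<Rightarrow> (nat \<Rightarrow> nat) set"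

definition well_posed :: "problem \<Rightarrow> bool" where
  "well_posed P \<longleftrightarrow> (\<forall>x\<in>instances P. solutions P x \<noteq> {})"

definition weihrauch_le :: "problem \<Rightarrow> problem \<Rightarrow> bool"  (infix \<open>\<le>\<^sub>W\<close> 50) where
  "P \<le>\<^sub>W Q \<longleftrightarrow>
     (\<exists>e d. \<forall>x\<in>instances P. \<exists>z\<in>instances Q.
        computes e x z \<and>
        (\<forall>y\<in>solutions Q z. \<exists>w\<in>solutions P x. computes d (join x y) w))"

text \<open>The triple of an oracle and two indices is coded as the sequence \<open>d, e, A 0, A 1, \<dots>\<close>.\<close>

definition triple :: "(nat \<Rightarrow> nat) \<Rightarrow> nat \<Rightarrow> nat \<Rightarrow> nat \<Rightarrow> nat" where
  "triple A d e n = (if n = 0 then d else if n = 1 then e else A (n - 2))"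

text \<open>A number, as a solution of the first-order part, is coded by the constant sequence.\<close>

definition first_order_part :: "problem \<Rightarrow> problem" where
  "first_order_part P =
    \<lparr> instances = {triple A d e | A d e. range A \<subseteq> {0, 1} \<and>
        (\<exists>z\<in>instances P. computes d A z \<and>
          (\<forall>y\<in>solutions P z. Phi e (join A y) 0 \<noteq> None))},
      solutions = (\<lambda>x. {\<lambda>_. v | v. \<exists>A d e z y. x = triple A d e \<and>
        computes d A z \<and> y \<in> solutions P z \<and> Phi e (join A y) 0 = Some v}) \<rparr>"


section \<open>Pigeonhole principles on numbers and on the binary tree\<close>

definition char_fun :: "nat set \<Rightarrow> nat \<Rightarrow> nat" where
  "char_fun M n = (if n \<in> M then 1 else 0)"

definition RT1N :: problem where
  "RT1N =
    \<lparr> instances = {g. finite (range g)},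
      solutions = (\<lambda>g. {char_fun M | M. infinite M \<and> (\<exists>c. \<forall>n\<in>M. g n = c)}) \<rparr>"

text \<open>
  Finite binary strings are elements of \<^typ>\<open>bool list\<close>, the head being the first bit. They are
  coded by their position in the length-lexicographic enumeration: \<open>[]\<close> has code \<open>0\<close>, and
  the two successors of a string with code \<open>n\<close> have codes \<open>2 * n + 1\<close> and \<open>2 * n + 2\<close>.
\<close>

definition str_code :: "bool list \<Rightarrow> nat" where
  "str_code s = foldl (\<lambda>n b. 2 * n + (if b then 2 else 1)) 0 s"

lemma str_code_Nil [simp]: "str_code [] = 0"
  and str_code_snoc [simp]: "str_code (s @ [b]) = 2 * str_code s + (if b then 2 else 1)"
  by (simp_all add: str_code_def)

lemma bij_str_code: "bij str_code"
proof (rule bijI)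
  have "str_code s = str_code t \<Longrightarrow> s = t" for s t
  proof (induction s arbitrary: t rule: rev_induct)
    case Nil
    then show ?case by (cases t rule: rev_cases) (auto split: if_splits)
  next
    case (snoc b s)
    then obtain t' b' where t: "t = t' @ [b']"
      by (cases t rule: rev_cases) (auto split: if_splits)
    have "str_code s = str_code t' \<and> b = b'"
      using snoc.prems unfolding t by (cases b; cases b'; simp; presburger)
    then show ?case using snoc.IH t by blast
  qed
  then show "inj str_code" by (rule injI)
  have "\<exists>s. str_code s = n" for n
  proof (induction n rule: less_induct)
    case (less n)
    show ?case
    proof (cases "n = 0")
      case True
      then show ?thesis using str_code_Nil by blast
    next
      case False
      then have "(n - 1) div 2 < n" by linarith
      then obtain s where "str_code s = (n - 1) div 2" using less by blast
      moreover have "2 * ((n - 1) div 2) + (if even n then 2 else 1) = n"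
        using False by presburger
      ultimately have "str_code (s @ [even n]) = n" by simp
      then show ?thesis by blast
    qed
  qed
  then show "surj str_code" by (metis surjI)
qed

definition iso_full_tree :: "bool list set \<Rightarrow> bool" where
  "iso_full_tree H \<longleftrightarrow>
     (\<exists>\<theta> :: bool list \<Rightarrow> bool list.
       bij_betw \<theta> UNIV H \<and> (\<forall>s t. prefix (\<theta> s) (\<theta> t) \<longleftrightarrow> prefix s t))"

definition TT1N :: problem where
  "TT1N =
    \<lparr> instances = {f. finite (range (\<lambda>s. f (str_code s)))},
      solutions = (\<lambda>f. {char_fun (str_code ` H) | H.
        iso_full_tree H \<and> (\<exists>c. \<forall>s\<in>H. f (str_code s) = c)}) \<rparr>"


section \<open>All these problems are well posed\<close>

lemma well_posed_first_order_part:
  assumes "well_posed P"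
  shows "well_posed (first_order_part P)"
  unfolding well_posed_def
proof
  fix x assume "x \<in> instances (first_order_part P)"
  then obtain A d e z where x: "x = triple A d e" "z \<in> instances P" "computes d A z"
    and e: "\<forall>y\<in>solutions P z. Phi e (join A y) 0 \<noteq> None"
    by (auto simp: first_order_part_def)
  obtain y where y: "y \<in> solutions P z"
    using assms x(2) by (auto simp: well_posed_def)
  then obtain v where "Phi e (join A y) 0 = Some v" using e by auto
  then have "(\<lambda>_. v) \<in> solutions (first_order_part P) x"
    unfolding first_order_part_def using x y by simp blast
  then show "solutions (first_order_part P) x \<noteq> {}" by blast
qed

lemma well_posed_RT1N: "well_posed RT1N"
  unfolding well_posed_def
proof
  fix g assume "g \<in> instances RT1N"
  then have "finite (range g)" by (simp add: RT1N_def)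
  then obtain c where "infinite {n. g n = c}"
    using pigeonhole_infinite[of UNIV g] by auto
  then have "char_fun {n. g n = c} \<in> solutions RT1N g"
    unfolding RT1N_def by force
  then show "solutions RT1N g \<noteq> {}" by blast
qed

lemma monochromatic_full_tree:
  fixes f :: "bool list \<Rightarrow> nat"
  assumes "finite (f ` {t. prefix s t})"
  shows "\<exists>H c. iso_full_tree H \<and> (\<forall>t\<in>H. f t = c)"
  using assms
proof (induction "card (f ` {t. prefix s t})" arbitrary: s rule: less_induct)
  case less
  show ?case
  proof (cases "\<exists>t. prefix s t \<and> f s \<notin> f ` {u. prefix t u}")
    case True
    then obtain t where t: "prefix s t" "f s \<notin> f ` {u. prefix t u}" by blast
    then have "f ` {u. prefix t u} \<subset> f ` {u. prefix s u}"
      by (auto intro: prefix_order.trans)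
    then show ?thesis
      using less by (meson finite_subset psubset_card_mono psubset_imp_subset)
  next
    case False
    then have "\<forall>t. \<exists>u. prefix s t \<longrightarrow> prefix t u \<and> f u = f s" by force
    then obtain g where g: "\<And>t. prefix s t \<Longrightarrow> prefix t (g t) \<and> f (g t) = f s" by metis
    define \<theta> where "\<theta> = foldl (\<lambda>t b. g (t @ [b])) s"
    have Nil: "\<theta> [] = s" and \<theta>_snoc: "\<theta> (r @ [b]) = g (\<theta> r @ [b])" for r b
      by (simp_all add: \<theta>_def)
    have s: "prefix s (\<theta> r)" for r
    proof (induction r rule: rev_induct)
      case (snoc b r)
      then show ?case
        unfolding \<theta>_snoc by (meson g prefix_order.trans prefixI prefix_prefix)
    qed (simp add: Nil)
    have step: "prefix (\<theta> r @ [b]) (\<theta> (r @ [b]))" for r b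
      unfolding \<theta>_snoc using g s by (meson prefix_prefix)
    have ext: "prefix (\<theta> r) (\<theta> (r @ q))" for r q
    proof (induction q rule: rev_induct)
      case (snoc b q)
      then show ?case
        using step[of "r @ q" b] by (metis append_assoc prefix_order.trans prefixI)
    qed simp
    have ext': "prefix (\<theta> r @ [b]) (\<theta> (r @ b # q))" for r b q
      using step[of r b] ext[of "r @ [b]" q] by (metis append_Cons append_Nil append_assoc
          prefix_order.trans)
    have mono: "prefix (\<theta> q) (\<theta> r) \<longleftrightarrow> prefix q r" for q r
    proof
      assume "prefix q r"
      then show "prefix (\<theta> q) (\<theta> r)" using ext by (auto simp: prefix_def)
    next
      assume p: "prefix (\<theta> q) (\<theta> r)"
      show "prefix q r"
      proof (rule ccontr)
        assume n: "\<not> prefix q r"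
        then consider (a) "strict_prefix r q" | (b) "parallel q r"
          unfolding parallel_def prefix_order.le_less by blast
        then show False
        proof cases
          case a
          then obtain b u where "q = r @ b # u" by (auto elim: strict_prefixE')
          then have "prefix (\<theta> r @ [b]) (\<theta> r)" using ext' p prefix_order.trans by blast
          then show False by (simp add: prefix_def)
        next
          case b
          obtain as x y xs ys where "x \<noteq> y" "q = as @ x # xs" "r = as @ y # ys"
            using parallel_decomp[OF b] by blast
          have "prefix (\<theta> as @ [x]) (\<theta> r)"
            using ext'[of as x xs] p unfolding \<open>q = _\<close> by (rule prefix_order.trans)
          moreover have "prefix (\<theta> as @ [y]) (\<theta> r)"
            using ext'[of as y ys] unfolding \<open>r = _\<close> .
          ultimately show False using \<open>x \<noteq> y\<close> by (auto simp: prefix_def)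
        qed
      qed
    qed
    have "inj \<theta>" by (rule injI) (metis mono prefix_order.order_antisym prefix_order.refl)
    then have "iso_full_tree (range \<theta>)"
      unfolding iso_full_tree_def using mono by (auto simp: bij_betw_def)
    moreover have "f (\<theta> r) = f s" for r
    proof (cases r rule: rev_cases)
      case (snoc q b)
      then show ?thesis using g[of "\<theta> q @ [b]"] s[of q] \<theta>_snoc by simp
    qed (simp add: Nil)
    ultimately show ?thesis by blast
  qed
qed

lemma well_posed_TT1N: "well_posed TT1N"
  unfolding well_posed_def
proof
  fix f assume "f \<in> instances TT1N"
  then have "finite (range (\<lambda>s. f (str_code s)))" by (simp add: TT1N_def)
  then have "finite ((\<lambda>s. f (str_code s)) ` {t. prefix [] t})" by simp
  then obtain H c where "iso_full_tree H" "\<forall>t\<in>H. f (str_code t) = c"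
    using monochromatic_full_tree[of "\<lambda>s. f (str_code s)"] by blast
  then have "char_fun (str_code ` H) \<in> solutions TT1N f"
    unfolding TT1N_def by auto
  then show "solutions TT1N f \<noteq> {}" by blast
qed

end

(*
  Call a colour somewhere dense above y if it is dense above some extension of y. Finite range
  ensures that such a colour exists, and if c is somewhere dense above every leaf of a finite
  monochromatic tree F of colour c, then F extends to a full solution that agrees with F below any
  given bound. So if Gamma converges on such an F within that bound, its value is a correct answer.

  Two things have to be guessed. First, for each y one computes stagewise a colour that is, from some
  stage on, somewhere dense above y (it need not converge). Secondly, one must choose F such that its
  colour is somewhere dense above all leaves. At stage s let F(z) be the first tree found above z whose
  colour is the current guess at z, and accept z relative to N if above every leaf of F(z) some node
  at most N has the same current guess as z. Moving from an unaccepted z to a bad leaf of F(z) excludes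
  a colour for good, so acceptance happens after at most as many steps as there are colours, hence for
  an N not depending on s. The values reported for the least accepted (N, z) therefore have finite
  range and are correct from some stage on, so a value that is reported infinitely often is correct.
*)

theory Submission
  imports Defs
begin

section \<open>Closure properties of total oracle functionals and decidable predicates\<close>

section \<open>Total computable functionals\<close>

abbreviation pair :: "nat \<Rightarrow> nat \<Rightarrow> nat" where "pair a b \<equiv> prod_encode (a, b)"
abbreviation pfst :: "nat \<Rightarrow> nat" where "pfst n \<equiv> fst (prod_decode n)"
abbreviation psnd :: "nat \<Rightarrow> nat" where "psnd n \<equiv> snd (prod_decode n)"

text \<open>Totality on every oracle lets functionals be composed without tracking convergence. The
  possibly partial functionals of an instance are never run directly; they enter through
  certificates, whose validity is decidable.\<close>

definition rec_fun :: "((nat \<Rightarrow> nat) \<Rightarrow> nat \<Rightarrow> nat) \<Rightarrow> bool" where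
  "rec_fun F \<longleftrightarrow> (\<exists>p. \<forall>X n. run p X n = Some (F X n))"

definition rec_pred :: "((nat \<Rightarrow> nat) \<Rightarrow> nat \<Rightarrow> bool) \<Rightarrow> bool" where
  "rec_pred P \<longleftrightarrow> rec_fun (\<lambda>X n. of_bool (P X n))"

definition bleast :: "(nat \<Rightarrow> bool) \<Rightarrow> nat \<Rightarrow> nat" where
  "bleast P k = (if \<exists>i<k. P i then LEAST i. P i else k)"

lemma bleast_holds: "bleast P k < k \<Longrightarrow> P (bleast P k)"
  unfolding bleast_def by (auto intro: LeastI split: if_splits)

lemma bleast_bound: "P i \<Longrightarrow> i < k \<Longrightarrow> bleast P k \<le> i"
  unfolding bleast_def by (auto intro: Least_le)

text \<open>Before step \<open>i\<close> the accumulator is below \<open>i\<close> if a witness has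
  been found and equals \<open>i\<close> otherwise, so one primitive recursion performs the search
  without a separate flag.\<close>

lemma bleast_rec:
  "bleast P k = rec_nat 0 (\<lambda>i r. if r < i then r else if P i then i else Suc i) k"
proof (induction k)
  case 0
  then show ?case by (simp add: bleast_def)
next
  case (Suc k)
  have "bleast P (Suc k) = (if bleast P k < k then bleast P k else if P k then k else Suc k)"
  proof (cases "\<exists>i<k. P i")
    case True
    then have "(LEAST i. P i) < k" by (meson Least_le le_less_trans)
    then show ?thesis using True by (auto simp: bleast_def less_Suc_eq)
  next
    case False
    then have "P k \<Longrightarrow> (LEAST i. P i) = k"
      by (intro Least_equality) (auto intro: leI)
    then show ?thesis using False by (auto simp: bleast_def less_Suc_eq)
  qed
  then show ?case using Suc by simp
qed

lemma rec_const: "rec_fun (\<lambda>X n. c)"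
proof -
  have "\<exists>p. \<forall>X n. run p X n = Some c"
  proof (induction c)
    case 0
    then show ?case by (intro exI[of _ Zero]) simp
  next
    case (Suc c)
    then obtain p where "\<forall>X n. run p X n = Some c" by blast
    then show ?case by (intro exI[of _ "Comp Succ p"]) simp
  qed
  then show ?thesis by (simp add: rec_fun_def)
qed

lemma rec_comp:
  assumes "rec_fun F" "rec_fun G"
  shows "rec_fun (\<lambda>X n. F X (G X n))"
proof -
  obtain p q where "\<forall>X n. run p X n = Some (F X n)" "\<forall>X n. run q X n = Some (G X n)"
    using assms unfolding rec_fun_def by blast
  then show ?thesis unfolding rec_fun_def by (intro exI[of _ "Comp p q"]) simp
qed

lemma rec_pair:
  assumes "rec_fun F" "rec_fun G"
  shows "rec_fun (\<lambda>X n. pair (F X n) (G X n))"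
proof -
  obtain p q where "\<forall>X n. run p X n = Some (F X n)" "\<forall>X n. run q X n = Some (G X n)"
    using assms unfolding rec_fun_def by blast
  then show ?thesis unfolding rec_fun_def by (intro exI[of _ "Tuple p q"]) simp
qed

lemma rec_Suc0: "rec_fun (\<lambda>X n. Suc n)"
  unfolding rec_fun_def by (intro exI[of _ Succ]) simp

lemma rec_pfst0: "rec_fun (\<lambda>X n. pfst n)"
  unfolding rec_fun_def by (intro exI[of _ Fst]) simp

lemma rec_psnd0: "rec_fun (\<lambda>X n. psnd n)"
  unfolding rec_fun_def by (intro exI[of _ Snd]) simp

lemma rec_query0: "rec_fun (\<lambda>X n. X n)"
  unfolding rec_fun_def by (intro exI[of _ Query]) simp

lemmas rec_Suc = rec_comp[OF rec_Suc0]
lemmas rec_pfst = rec_comp[OF rec_pfst0]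
lemmas rec_psnd = rec_comp[OF rec_psnd0]
lemmas rec_query = rec_comp[OF rec_query0]

lemma rec_id: "rec_fun (\<lambda>X n. n)"
proof -
  \<comment> \<open>No basic program is the identity; pairing the two projections of
    \<open>n\<close> gives \<open>n\<close> back.\<close>
  have "\<forall>X n. run (Tuple Fst Snd) X n = Some n" by simp
  then show ?thesis unfolding rec_fun_def by blast
qed

text \<open>\<open>Rec\<close> carries its parameter along, which is why the step function may
  depend on the input \<open>n\<close>. The count is supplied by composing with
  \<open>pair n (k X n)\<close>.\<close>

lemma rec_rec:
  assumes "rec_fun a" "rec_fun (\<lambda>X m. b X (pfst m) (pfst (psnd m)) (psnd (psnd m)))" "rec_fun k"
  shows "rec_fun (\<lambda>X n. rec_nat (a X n) (\<lambda>i r. b X n i r) (k X n))"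
proof -
  obtain p q where p: "\<forall>X n. run p X n = Some (a X n)"
    and q: "\<forall>X m. run q X m = Some (b X (pfst m) (pfst (psnd m)) (psnd (psnd m)))"
    using assms(1,2) unfolding rec_fun_def by blast
  have "run (Rec p q) X (pair n j) = Some (rec_nat (a X n) (\<lambda>i r. b X n i r) j)" for X n j
    by (induction j) (simp_all add: p q)
  then have "\<forall>X m. run (Rec p q) X m = Some (rec_nat (a X (pfst m)) (\<lambda>i r. b X (pfst m) i r) (psnd m))"
    by (metis prod.collapse prod_decode_inverse)
  then have "rec_fun (\<lambda>X m. rec_nat (a X (pfst m)) (\<lambda>i r. b X (pfst m) i r) (psnd m))"
    unfolding rec_fun_def by blast
  from rec_comp[OF this rec_pair[OF rec_id assms(3)]] show ?thesis by simp
qed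

lemma rec_if:
  assumes "rec_pred P" "rec_fun F" "rec_fun G"
  shows "rec_fun (\<lambda>X n. if P X n then F X n else G X n)"
proof -
  \<comment> \<open>A case distinction is a recursion of length 0 or 1.\<close>
  have "rec_fun (\<lambda>X n. rec_nat (G X n) (\<lambda>i r. F X n) (of_bool (P X n)))"
    by (intro rec_rec rec_comp[OF assms(2)] assms rec_pfst rec_id assms(1)[unfolded rec_pred_def])
  moreover have "rec_nat (G X n) (\<lambda>i r. F X n) (of_bool (P X n)) = (if P X n then F X n else G X n)"
    for X n by simp
  ultimately show ?thesis by simp
qed

lemma rec_pred_comp:
  "rec_pred P \<Longrightarrow> rec_fun G \<Longrightarrow> rec_pred (\<lambda>X n. P X (G X n))"
  unfolding rec_pred_def by (rule rec_comp)

lemma rec_bool: "rec_pred (\<lambda>X n. b)"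
  unfolding rec_pred_def by (rule rec_const)

lemma rec_pred_if:
  assumes "rec_pred P" "rec_pred Q" "rec_pred R"
  shows "rec_pred (\<lambda>X n. if P X n then Q X n else R X n)"
  using rec_if[OF assms(1) assms(2,3)[unfolded rec_pred_def]]
  unfolding rec_pred_def by (simp add: if_distrib)

lemma rec_not:
  assumes "rec_pred P"
  shows "rec_pred (\<lambda>X n. \<not> P X n)"
proof -
  have *: "(\<not> a) = (if a then False else True)" for a by simp
  show ?thesis unfolding * by (intro rec_pred_if rec_bool assms)
qed

lemma rec_conj:
  assumes "rec_pred P" "rec_pred Q"
  shows "rec_pred (\<lambda>X n. P X n \<and> Q X n)"
proof -
  have *: "(a \<and> b) = (if a then b else False)" for a b by simp
  show ?thesis unfolding * by (intro rec_pred_if rec_bool assms)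
qed

lemma rec_disj:
  assumes "rec_pred P" "rec_pred Q"
  shows "rec_pred (\<lambda>X n. P X n \<or> Q X n)"
proof -
  have *: "(a \<or> b) = (if a then True else b)" for a b by simp
  show ?thesis unfolding * by (intro rec_pred_if rec_bool assms)
qed

lemma rec_imp:
  assumes "rec_pred P" "rec_pred Q"
  shows "rec_pred (\<lambda>X n. P X n \<longrightarrow> Q X n)"
proof -
  have *: "(a \<longrightarrow> b) = (if a then b else True)" for a b by simp
  show ?thesis unfolding * by (intro rec_pred_if rec_bool assms)
qed

lemma rec_plus:
  assumes "rec_fun F" "rec_fun G"
  shows "rec_fun (\<lambda>X n. F X n + G X n)"
proof -
  have *: "rec_nat a (\<lambda>i r. Suc r) b = a + b" for a b :: nat by (induction b) auto
  show ?thesis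
    unfolding *[symmetric] by (intro rec_rec assms rec_Suc rec_psnd rec_id)
qed

lemma rec_decrement: "rec_fun F \<Longrightarrow> rec_fun (\<lambda>X n. F X n - 1)"
proof -
  assume F: "rec_fun F"
  have *: "rec_nat 0 (\<lambda>i r. i) b = b - 1" for b :: nat by (cases b) auto
  show ?thesis
    unfolding *[symmetric] by (intro rec_rec F rec_const rec_pfst rec_psnd rec_id)
qed

lemma rec_minus:
  assumes "rec_fun F" "rec_fun G"
  shows "rec_fun (\<lambda>X n. F X n - G X n)"
proof -
  have *: "rec_nat a (\<lambda>i r. r - 1) b = a - b" for a b :: nat by (induction b) auto
  have "rec_fun (\<lambda>X n. rec_nat (F X n) (\<lambda>i r. r - 1) (G X n))"
    by (intro rec_rec assms rec_decrement rec_psnd rec_id)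
  then show ?thesis by (simp only: *)
qed

lemma rec_less:
  assumes "rec_fun F" "rec_fun G"
  shows "rec_pred (\<lambda>X n. F X n < G X n)"
proof -
  have *: "of_bool (a < b) = rec_nat (0 :: nat) (\<lambda>i r. 1) (b - a)" for a b :: nat
    by (cases "b - a") auto
  show ?thesis
    unfolding rec_pred_def * by (intro rec_rec rec_const rec_minus assms)
qed

lemma rec_le:
  assumes "rec_fun F" "rec_fun G"
  shows "rec_pred (\<lambda>X n. F X n \<le> G X n)"
  unfolding not_less[symmetric] by (intro rec_not rec_less assms)

lemma rec_eq:
  assumes "rec_fun F" "rec_fun G"
  shows "rec_pred (\<lambda>X n. F X n = G X n)"
  unfolding order.eq_iff by (intro rec_conj rec_le assms)

lemma rec_ex_less:
  assumes "rec_pred (\<lambda>X m. P X (pfst m) (psnd m))" "rec_fun K"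
  shows "rec_pred (\<lambda>X n. \<exists>i<K X n. P X n i)"
proof -
  have "rec_nat 0 (\<lambda>i r. if Q i then Suc 0 else r) k = of_bool (\<exists>i<k. Q i)" for Q k
    by (induction k) (simp_all add: less_Suc_eq ex_disj_distrib conj_disj_distribR)
  note * = this[symmetric]
  have P: "rec_pred (\<lambda>X m. P X (pfst m) (pfst (psnd m)))"
    using rec_pred_comp[OF assms(1) rec_pair[OF rec_pfst0 rec_pfst[OF rec_psnd0]]] by simp
  then show ?thesis
    unfolding rec_pred_def * by (intro rec_rec rec_if P rec_const rec_psnd rec_id assms(2))
qed

lemma rec_ex_le:
  assumes "rec_pred (\<lambda>X m. P X (pfst m) (psnd m))" "rec_fun K"
  shows "rec_pred (\<lambda>X n. \<exists>i\<le>K X n. P X n i)"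
  unfolding less_Suc_eq_le[symmetric] by (intro rec_ex_less rec_Suc assms)

lemma rec_all_less:
  assumes "rec_pred (\<lambda>X m. P X (pfst m) (psnd m))" "rec_fun K"
  shows "rec_pred (\<lambda>X n. \<forall>i<K X n. P X n i)"
  using rec_not[OF rec_ex_less[OF rec_not[OF assms(1)] assms(2)]] by simp

lemma rec_all_le:
  assumes "rec_pred (\<lambda>X m. P X (pfst m) (psnd m))" "rec_fun K"
  shows "rec_pred (\<lambda>X n. \<forall>i\<le>K X n. P X n i)"
  unfolding less_Suc_eq_le[symmetric] by (intro rec_all_less rec_Suc assms)

lemma rec_bleast:
  assumes "rec_pred (\<lambda>X m. P X (pfst m) (psnd m))" "rec_fun K"
  shows "rec_fun (\<lambda>X n. bleast (\<lambda>i. P X n i) (K X n))"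
proof -
  have P: "rec_pred (\<lambda>X m. P X (pfst m) (pfst (psnd m)))"
    using rec_pred_comp[OF assms(1) rec_pair[OF rec_pfst0 rec_pfst[OF rec_psnd0]]] by simp
  show ?thesis
    unfolding bleast_rec
    by (intro rec_rec rec_if P rec_const rec_less rec_Suc rec_psnd rec_pfst rec_id assms(2))
qed

lemma rec_div:
  assumes "rec_fun F" "0 < k"
  shows "rec_fun (\<lambda>X n. F X n div k)"
proof -
  have *: "rec_nat 0 (\<lambda>i r. if r = k - 1 then 0 else Suc r) b = b mod k" for b
    using assms(2) by (induction b) (auto simp: mod_Suc)
  \<comment> \<open>The quotient grows whenever the remainder, recomputed by the inner recursion, is
    about to wrap around.\<close>
  have **: "b div k = rec_nat 0 (\<lambda>i r. if rec_nat 0 (\<lambda>i r. if r = k - 1 then 0 else Suc r) i = k - 1 then Suc r else r) b"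
    for b
    unfolding * using assms(2) by (induction b) (auto simp: div_Suc mod_Suc)
  show ?thesis
    unfolding **
    by (intro rec_rec rec_if rec_eq rec_const rec_Suc rec_psnd rec_pfst rec_id assms)
qed

lemma rec_mod:
  assumes "rec_fun F" "0 < k"
  shows "rec_fun (\<lambda>X n. F X n mod k)"
proof -
  have *: "b mod k = rec_nat 0 (\<lambda>i r. if r = k - 1 then 0 else Suc r) b" for b
    using assms(2) by (induction b) (auto simp: mod_Suc)
  show ?thesis
    unfolding *
    by (intro rec_rec rec_if rec_eq rec_const rec_Suc rec_psnd rec_id assms)
qed

lemmas rec_intros =
  rec_id rec_const rec_query rec_Suc rec_pfst rec_psnd rec_pair rec_plus rec_minus rec_div rec_mod
  rec_bool rec_not rec_conj rec_disj rec_imp rec_eq rec_less rec_le rec_ex_less rec_ex_le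
  rec_all_less rec_all_le rec_bleast rec_if rec_pred_if rec_rec

text \<open>For the backward functional, which sees a join but has to evaluate the forward
  functional on its left half: every query is redirected to an even position.\<close>

lemma rec_fun_join_left:
  assumes "rec_fun F"
  shows "rec_fun (\<lambda>Z n. F (\<lambda>i. Z (2 * i)) n)"
proof -
  \<comment> \<open>Stated for all programs, since subprograms of a total program may be
    partial.\<close>
  have "\<exists>p'. \<forall>Z. run p' Z = run p (\<lambda>i. Z (2 * i))" for p
  proof (induction p)
    case Query
    have "rec_fun (\<lambda>Z n. Z (n + n))" by (intro rec_query rec_plus rec_id)
    then obtain p' where "\<forall>Z n. run p' Z n = Some (Z (n + n))" unfolding rec_fun_def by blast
    then show ?case by (intro exI[of _ p']) (auto simp: mult_2)
  next
    case (Tuple p q)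
    then obtain p' q' where "\<forall>Z. run p' Z = run p (\<lambda>i. Z (2 * i))" "\<forall>Z. run q' Z = run q (\<lambda>i. Z (2 * i))"
      by blast
    then show ?case by (intro exI[of _ "prog.Tuple p' q'"]) (auto intro!: ext cong del: option.case_cong_weak)
  next
    case (Comp p q)
    then obtain p' q' where "\<forall>Z. run p' Z = run p (\<lambda>i. Z (2 * i))" "\<forall>Z. run q' Z = run q (\<lambda>i. Z (2 * i))"
      by blast
    then show ?case by (intro exI[of _ "prog.Comp p' q'"]) (auto intro!: ext cong del: option.case_cong_weak)
  next
    case (Rec p q)
    then obtain p' q' where "\<forall>Z. run p' Z = run p (\<lambda>i. Z (2 * i))" "\<forall>Z. run q' Z = run q (\<lambda>i. Z (2 * i))"
      by blast
    then show ?case by (intro exI[of _ "prog.Rec p' q'"]) (auto intro!: ext cong del: option.case_cong_weak)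
  next
    case (Min p)
    then obtain p' where "\<forall>Z. run p' Z = run p (\<lambda>i. Z (2 * i))" by blast
    then show ?case by (intro exI[of _ "prog.Min p'"]) (auto intro!: ext cong del: option.case_cong_weak)
  qed (rule exI[of _ Zero] exI[of _ Succ] exI[of _ Fst] exI[of _ Snd]; auto intro!: ext)+
  then show ?thesis using assms unfolding rec_fun_def by metis
qed

section \<open>Finite certificates for convergent oracle computations\<close>

section \<open>Certificates for computations\<close>

definition lhd :: "nat \<Rightarrow> nat" where "lhd u = pfst (u - 1)"

definition ldrop :: "nat \<Rightarrow> nat \<Rightarrow> nat" where
  "ldrop w i = rec_nat w (\<lambda>_ u. psnd (u - 1)) i"

definition lnth :: "nat \<Rightarrow> nat \<Rightarrow> nat" where "lnth w i = lhd (ldrop w i)"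

text \<open>A list is no longer than its code, so bounding the index by \<open>w\<close> misses no
  entry.\<close>

definition lmem :: "nat \<Rightarrow> nat \<Rightarrow> bool" where
  "lmem x w \<longleftrightarrow> (\<exists>i<w. ldrop w i \<noteq> 0 \<and> lnth w i = x)"

lemma ldrop_encode: "ldrop (list_encode xs) i = list_encode (drop i xs)"
proof -
  \<comment> \<open>The tail operation applied to the empty list decodes \<open>0\<close> and must
    return the code \<open>0\<close> again.\<close>
  have "prod_decode 0 = (0, 0)"
    using prod_encode_inverse[of "(0, 0)"] by (simp add: prod_encode_def)
  then have *: "psnd (list_encode xs - Suc 0) = list_encode (tl xs)" for xs
    by (cases xs) simp_all
  show ?thesis
    by (induction i) (simp_all add: ldrop_def * drop_Suc tl_drop)
qed

lemma lnth_encode: "i < length xs \<Longrightarrow> lnth (list_encode xs) i = xs ! i"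
  unfolding lnth_def ldrop_encode lhd_def by (subst Cons_nth_drop_Suc[symmetric]) simp_all

lemma length_le_encode: "length xs \<le> list_encode xs"
proof (induction xs)
  case (Cons x xs)
  have "list_encode xs \<le> pair x (list_encode xs)" by (rule le_prod_encode_2)
  then show ?case using Cons by simp
qed simp

lemma less_encode: "x \<in> set xs \<Longrightarrow> x < list_encode xs"
proof (induction xs)
  case (Cons y xs)
  have "list_encode xs \<le> pair y (list_encode xs)" "y \<le> pair y (list_encode xs)"
    by (rule le_prod_encode_2 le_prod_encode_1)+
  then show ?case using Cons by auto
qed simp

lemma ldrop_eq_0_iff: "ldrop (list_encode xs) i = 0 \<longleftrightarrow> length xs \<le> i"
proof -
  have "list_encode ys = 0 \<longleftrightarrow> ys = []" for ys by (cases ys) simp_all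
  then show ?thesis by (simp add: ldrop_encode)
qed

lemma lmem_encode: "lmem x (list_encode xs) \<longleftrightarrow> x \<in> set xs"
proof -
  have "lmem x (list_encode xs) \<longleftrightarrow> (\<exists>i<length xs. xs ! i = x)"
    using length_le_encode[of xs]
    by (auto simp: lmem_def ldrop_eq_0_iff not_le lnth_encode intro: less_le_trans)
  then show ?thesis by (simp add: in_set_conv_nth)
qed

lemma rec_comp2:
  assumes "rec_fun (\<lambda>X m. H X (pfst m) (psnd m))" "rec_fun F" "rec_fun G"
  shows "rec_fun (\<lambda>X n. H X (F X n) (G X n))"
  using rec_comp[OF assms(1) rec_pair[OF assms(2,3)]] by simp

lemma rec_pred_comp2:
  assumes "rec_pred (\<lambda>X m. H X (pfst m) (psnd m))" "rec_fun F" "rec_fun G"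
  shows "rec_pred (\<lambda>X n. H X (F X n) (G X n))"
  using rec_comp2[OF assms(1)[unfolded rec_pred_def] assms(2,3)] unfolding rec_pred_def .

lemma rec_lhd: "rec_fun F \<Longrightarrow> rec_fun (\<lambda>X n. lhd (F X n))"
  unfolding lhd_def by (intro rec_intros)

lemma rec_ldrop: "rec_fun F \<Longrightarrow> rec_fun G \<Longrightarrow> rec_fun (\<lambda>X n. ldrop (F X n) (G X n))"
  unfolding ldrop_def by (intro rec_intros)

lemma rec_lnth: "rec_fun F \<Longrightarrow> rec_fun G \<Longrightarrow> rec_fun (\<lambda>X n. lnth (F X n) (G X n))"
  unfolding lnth_def by (intro rec_lhd rec_ldrop)

lemma rec_lmem:
  assumes "rec_fun F" "rec_fun G"
  shows "rec_pred (\<lambda>X n. lmem (F X n) (G X n))"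
proof -
  have "rec_pred (\<lambda>X m. lmem (pfst m) (psnd m))"
    unfolding lmem_def by (intro rec_intros rec_lnth rec_ldrop)
  from rec_pred_comp2[OF this assms] show ?thesis .
qed

abbreviation claim :: "nat \<Rightarrow> nat \<Rightarrow> nat \<Rightarrow> nat" where "claim e n v \<equiv> pair e (pair n v)"

lemma claim_le: "e \<le> claim e n v" "n \<le> claim e n v" "v \<le> claim e n v"
  by (rule order.trans[OF _ le_prod_encode_2] le_prod_encode_1 le_prod_encode_2)+

text \<open>
  A certificate is a coded list of claims \<open>(e, n, v)\<close>, read as ``program \<open>e\<close> halts on \<open>n\<close> with
  value \<open>v\<close>'', each of which follows in one step from the claims further down the list.
  A certificate \<open>w\<close> only mentions numbers below \<open>w\<close>, so \<open>w\<close> bounds the use of the computation.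
\<close>

definition justified :: "(nat \<Rightarrow> nat) \<Rightarrow> nat \<Rightarrow> nat \<Rightarrow> nat \<Rightarrow> nat \<Rightarrow> bool" where
  "justified Or u e n v \<longleftrightarrow>
     (e = 0 \<and> v = 0) \<or> (e = 1 \<and> v = Suc n) \<or> (e = 2 \<and> v = pfst n) \<or> (e = 3 \<and> v = psnd n) \<or>
     (e = 4 \<and> v = Or n) \<or>
     (5 \<le> e \<and> (e - 5) mod 4 = 0 \<and>
        lmem (claim (pfst ((e - 5) div 4)) n (pfst v)) u \<and>
        lmem (claim (psnd ((e - 5) div 4)) n (psnd v)) u) \<or>
     (5 \<le> e \<and> (e - 5) mod 4 = 1 \<and>
        (\<exists>r<u. lmem (claim (psnd ((e - 5) div 4)) n r) u \<and>
               lmem (claim (pfst ((e - 5) div 4)) r v) u)) \<or>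
     (5 \<le> e \<and> (e - 5) mod 4 = 2 \<and> psnd n = 0 \<and>
        lmem (claim (pfst ((e - 5) div 4)) (pfst n) v) u) \<or>
     (5 \<le> e \<and> (e - 5) mod 4 = 2 \<and> psnd n \<noteq> 0 \<and>
        (\<exists>r<u. lmem (claim e (pair (pfst n) (psnd n - 1)) r) u \<and>
               lmem (claim (psnd ((e - 5) div 4)) (pair (pfst n) (pair (psnd n - 1) r)) v) u)) \<or>
     (5 \<le> e \<and> (e - 5) mod 4 = 3 \<and>
        lmem (claim ((e - 5) div 4) (pair n v) 0) u \<and>
        (\<forall>j<v. \<exists>r<u. lmem (claim ((e - 5) div 4) (pair n j) (Suc r)) u))"

definition trace :: "(nat \<Rightarrow> nat) \<Rightarrow> nat \<Rightarrow> bool" where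
  "trace Or w \<longleftrightarrow> (\<forall>i<w. ldrop w i = 0 \<or>
     justified Or (ldrop w (Suc i)) (pfst (lnth w i)) (pfst (psnd (lnth w i))) (psnd (psnd (lnth w i))))"

text \<open>The oracle may depend on a parameter because it will later be the join of a fixed oracle
  with a finite set read off a candidate.\<close>

lemma rec_justified:
  assumes "rec_fun (\<lambda>X m. Or X (pfst m) (psnd m))"
    and "rec_fun C" "rec_fun U" "rec_fun E" "rec_fun N" "rec_fun V"
  shows "rec_pred (\<lambda>X n. justified (Or X (C X n)) (U X n) (E X n) (N X n) (V X n))"
proof -
  have "rec_pred (\<lambda>X m. justified (Or X (pfst m)) (pfst (psnd m)) (pfst (psnd (psnd m)))
      (pfst (psnd (psnd (psnd m)))) (psnd (psnd (psnd (psnd m)))))"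
    unfolding justified_def
    by (intro rec_intros rec_lmem rec_comp2[OF assms(1)]) simp_all
  from rec_pred_comp[OF this, of "\<lambda>X n. pair (C X n) (pair (U X n) (pair (E X n) (pair (N X n) (V X n))))"]
  show ?thesis using assms by (simp add: rec_pair)
qed

lemma rec_trace:
  assumes "rec_fun (\<lambda>X m. Or X (pfst m) (psnd m))" and "rec_fun C" "rec_fun W"
  shows "rec_pred (\<lambda>X n. trace (Or X (C X n)) (W X n))"
proof -
  have "rec_pred (\<lambda>X m. trace (Or X (pfst m)) (psnd m))"
    unfolding trace_def
    by (intro rec_intros rec_justified[OF assms(1)] rec_lnth rec_ldrop)
  from rec_pred_comp2[OF this assms(2,3)] show ?thesis .
qed

lemma trace_Nil: "trace Or (list_encode [])"
  by (simp add: trace_def)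

lemma trace_Cons:
  "trace Or (list_encode (claim e n v # xs)) \<longleftrightarrow>
     justified Or (list_encode xs) e n v \<and> trace Or (list_encode xs)"
proof -
  have tr: "trace Or (list_encode ys) \<longleftrightarrow> (\<forall>i<length ys. justified Or (list_encode (drop (Suc i) ys))
      (pfst (ys ! i)) (pfst (psnd (ys ! i))) (psnd (psnd (ys ! i))))" (is "_ \<longleftrightarrow> (\<forall>i<_. ?J ys i)") for ys
  proof -
    have "trace Or (list_encode ys) \<longleftrightarrow> (\<forall>i<list_encode ys. length ys \<le> i \<or> ?J ys i)"
      unfolding trace_def ldrop_eq_0_iff by (simp add: ldrop_encode) (metis lnth_encode not_le)
    then show ?thesis using length_le_encode[of ys] by (metis less_le_trans not_le)
  qed
  show ?thesis
    unfolding tr by (auto simp: less_Suc_eq_0_disj)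
qed

text \<open>Besides membership, the bounds \<open>r < u\<close> must survive the change of list;
  they do, since a number occurring in a claim of a list is below the code of that list.\<close>

lemma justified_mono:
  assumes "justified Or (list_encode xs) e n v" "set xs \<subseteq> set ys"
  shows "justified Or (list_encode ys) e n v"
proof -
  have m: "lmem c (list_encode ys)" if "lmem c (list_encode xs)" for c
    using that assms(2) by (auto simp: lmem_encode)
  have b: "r < list_encode ys" if "lmem (claim a k r) (list_encode ys)" for a k r
    using that less_encode claim_le(3) unfolding lmem_encode by (meson le_less_trans)
  have b': "r < list_encode ys" if "lmem (claim a k (Suc r)) (list_encode ys)" for a k r
    using b[OF that] by simp
  let ?X = "list_encode xs" and ?Y = "list_encode ys"
  have E: "\<exists>r<?Y. lmem (claim a k r) ?Y \<and> lmem (f r) ?Y"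
    if "\<exists>r<?X. lmem (claim a k r) ?X \<and> lmem (f r) ?X" for a k f
    using that m b by blast
  have A: "\<forall>j<v. \<exists>r<?Y. lmem (claim a (pair n j) (Suc r)) ?Y"
    if "\<forall>j<v. \<exists>r<?X. lmem (claim a (pair n j) (Suc r)) ?X" for a
    using that m b' by meson
  show ?thesis
    using assms(1) unfolding justified_def by (elim disjE conjE; simp add: m E A)
qed

lemma trace_append:
  "trace Or (list_encode xs) \<Longrightarrow> trace Or (list_encode ys) \<Longrightarrow> trace Or (list_encode (xs @ ys))"
proof (induction xs)
  case (Cons c xs)
  have c: "claim (pfst c) (pfst (psnd c)) (psnd (psnd c)) = c" by simp
  show ?case
    using Cons trace_Cons[of Or "pfst c" "pfst (psnd c)" "psnd (psnd c)"]
    unfolding c append_Cons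
    by (metis justified_mono Un_upper1 set_append)
qed simp

definition certified :: "(nat \<Rightarrow> nat) \<Rightarrow> nat \<Rightarrow> bool" where
  "certified Or c \<longleftrightarrow> (\<exists>w. trace Or w \<and> lmem c w)"

lemma certified_list: "certified Or c \<longleftrightarrow> (\<exists>xs. trace Or (list_encode xs) \<and> c \<in> set xs)"
  unfolding certified_def by (metis lmem_encode list_decode_inverse)

lemma certified_finite:
  assumes "finite C" "\<And>c. c \<in> C \<Longrightarrow> certified Or c"
  shows "\<exists>xs. trace Or (list_encode xs) \<and> C \<subseteq> set xs"
  using assms
proof (induction C rule: finite_induct)
  case empty
  then show ?case using trace_Nil by blast
next
  case (insert c C)
  then obtain xs ys where "trace Or (list_encode xs)" "C \<subseteq> set xs" "trace Or (list_encode ys)" "c \<in> set ys"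
    using certified_list by (metis insertI1 insertI2)
  then show ?case using trace_append[of Or xs ys] by (intro exI[of _ "xs @ ys"]) auto
qed

text \<open>The certificates of the premises \<open>C\<close> are merged into one list and the new
  claim is put on top. Quantifying over all \<open>u\<close> makes the shape of the merged list
  irrelevant.\<close>

lemma certified_by:
  assumes "finite C" "\<And>c. c \<in> C \<Longrightarrow> certified Or c"
    and "\<And>u. (\<And>c. c \<in> C \<Longrightarrow> lmem c u) \<Longrightarrow> justified Or u e n v"
  shows "certified Or (claim e n v)"
proof -
  obtain xs where xs: "trace Or (list_encode xs)" "C \<subseteq> set xs"
    using certified_finite[OF assms(1,2)] by blast
  then have "justified Or (list_encode xs) e n v" by (intro assms(3)) (auto simp: lmem_encode)
  then have "trace Or (list_encode (claim e n v # xs))" using xs trace_Cons by blast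
  then show ?thesis unfolding certified_list by (intro exI[of _ "claim e n v # xs"]) simp
qed

lemma lmem_claim_less: "lmem (claim e n r) u \<Longrightarrow> r < u"
  using less_encode claim_le(3) by (metis le_less_trans list_decode_inverse lmem_encode)

text \<open>Completeness of certificates, by induction on the index. Recursion refers back to its
  own index and needs an inner induction on the number of rounds.\<close>

lemma certified_run:
  "run (prog_of e) Or n = Some v \<Longrightarrow> certified Or (claim e n v)"
proof (induction e arbitrary: n v rule: less_induct)
  case (less e)
  define m where "m = (e - 5) div 4"
  define a where "a = pfst m"
  define b where "b = psnd m"
  show ?case
  proof (cases "e < 5")
    case True
    then consider "e = 0" | "e = 1" | "e = 2" | "e = 3" | "e = 4" by linarith
    then have "justified Or u e n v" for u
      using less.prems by cases (auto simp: justified_def prog_of_eqs prog_of_eqs(2)[unfolded One_nat_def])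
    then show ?thesis by (intro certified_by[of "{}"]) auto
  next
    case False
    have le: "a \<le> m" "b \<le> m"
      unfolding a_def b_def by (metis le_prod_encode_1 le_prod_encode_2 prod.collapse prod_decode_inverse)+
    then have lt: "a < e" "b < e" "m < e" using False unfolding m_def by linarith+
    have "(e - 5) mod 4 < 4" by simp
    then consider (0) "(e - 5) mod 4 = 0" | (1) "(e - 5) mod 4 = 1" | (2) "(e - 5) mod 4 = 2"
      | (3) "(e - 5) mod 4 = 3" by linarith
    then show ?thesis
    proof cases
      case 0
      then have "prog_of e = Tuple (prog_of a) (prog_of b)"
        using False by (subst prog_of.simps) (simp add: a_def b_def m_def Let_def)
      then have "run (prog_of a) Or n = Some (pfst v)" "run (prog_of b) Or n = Some (psnd v)"
        using less.prems by (auto split: option.splits)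
      then have "certified Or (claim a n (pfst v))" "certified Or (claim b n (psnd v))"
        using less.IH lt by blast+
      then show ?thesis
        using 0 False
        by (intro certified_by[of "{claim a n (pfst v), claim b n (psnd v)}"])
          (auto simp: justified_def a_def b_def m_def)
    next
      case 1
      then have "prog_of e = Comp (prog_of a) (prog_of b)"
        using False by (subst prog_of.simps) (simp add: a_def b_def m_def Let_def)
      then obtain r where "run (prog_of b) Or n = Some r" "run (prog_of a) Or r = Some v"
        using less.prems by (auto split: option.splits)
      then have "certified Or (claim b n r)" "certified Or (claim a r v)"
        using less.IH lt by blast+
      then show ?thesis
        using 1 False lmem_claim_less[of b n r]
        by (intro certified_by[of "{claim b n r, claim a r v}"])
          (auto simp: justified_def a_def b_def m_def)
    next
      case 2
      then have p: "prog_of e = Rec (prog_of a) (prog_of b)"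
        using False by (subst prog_of.simps) (simp add: a_def b_def m_def Let_def)
      have "run (prog_of e) Or (pair x k) = Some r \<Longrightarrow> certified Or (claim e (pair x k) r)" for x k r
      proof (induction k arbitrary: r)
        case 0
        then have "certified Or (claim a x r)" using less.IH lt p by simp
        then show ?case
          using 2 False by (intro certified_by[of "{claim a x r}"])
            (auto simp: justified_def a_def m_def)
      next
        case (Suc k)
        then obtain t where t: "run (prog_of e) Or (pair x k) = Some t"
          "run (prog_of b) Or (pair x (pair k t)) = Some r"
          unfolding p by (auto split: option.splits)
        then have "certified Or (claim e (pair x k) t)" "certified Or (claim b (pair x (pair k t)) r)"
          using less.IH lt Suc.IH by blast+
        then show ?case
          using 2 False lmem_claim_less[of e "pair x k" t]
          by (intro certified_by[of "{claim e (pair x k) t, claim b (pair x (pair k t)) r}"])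
            (auto simp: justified_def b_def m_def)
      qed
      from this[of "pfst n" "psnd n" v] show ?thesis using less.prems by simp
    next
      case 3
      then have p: "prog_of e = Min (prog_of m)"
        using False by (subst prog_of.simps) (simp add: m_def Let_def)
      let ?r = "run (prog_of m) Or"
      have ex: "\<exists>k. ?r (pair n k) = Some 0 \<and> (\<forall>j<k. ?r (pair n j) \<noteq> None)"
        and v: "v = (LEAST k. ?r (pair n k) = Some 0)"
        using less.prems unfolding p by (auto split: if_splits)
      have v0: "?r (pair n v) = Some 0" unfolding v using ex by (metis (mono_tags, lifting) LeastI)
      have "\<exists>r. ?r (pair n j) = Some (Suc r)" if "j < v" for j
      proof -
        from ex obtain k where k: "?r (pair n k) = Some 0" "\<forall>j<k. ?r (pair n j) \<noteq> None" by blast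
        then have "v \<le> k" unfolding v by (metis (mono_tags, lifting) Least_le)
        then have "?r (pair n j) \<noteq> None" using that k by auto
        moreover have "?r (pair n j) \<noteq> Some 0" using that not_less_Least unfolding v by blast
        ultimately show ?thesis by (metis not0_implies_Suc option.exhaust)
      qed
      then obtain g where g: "\<And>j. j < v \<Longrightarrow> ?r (pair n j) = Some (Suc (g j))" by metis
      \<comment> \<open>A search succeeding at \<open>v\<close> rests on finitely many claims: value
        0 at \<open>v\<close> and a nonzero value at each smaller argument.\<close>
      let ?C = "insert (claim m (pair n v) 0) ((\<lambda>j. claim m (pair n j) (Suc (g j))) ` {..<v})"
      have "certified Or c" if "c \<in> ?C" for c
        using that less.IH[OF lt(3)] v0 g by auto
      moreover have "justified Or u e n v" if "\<And>c. c \<in> ?C \<Longrightarrow> lmem c u" for u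
      proof -
        have "lmem (claim m (pair n j) (Suc (g j))) u" if "j < v" for j using that \<open>\<And>c. c \<in> ?C \<Longrightarrow> lmem c u\<close> by auto
        moreover from this have "g j < u" if "j < v" for j using lmem_claim_less that by (meson Suc_lessD)
        ultimately show ?thesis using 3 False \<open>\<And>c. c \<in> ?C \<Longrightarrow> lmem c u\<close>
          by (auto simp: justified_def m_def)
      qed
      ultimately show ?thesis by (intro certified_by[of ?C]) auto
    qed
  qed
qed

text \<open>Induction on the list: the head claim is justified by claims of the tail, which are true
  by the induction hypothesis.\<close>

lemma trace_sound:
  assumes "trace Or w" "lmem (claim e n v) w"
  shows "run (prog_of e) Or n = Some v"
proof -
  have "trace Or (list_encode xs) \<Longrightarrow> claim e n v \<in> set xs \<Longrightarrow> run (prog_of e) Or n = Some v" for xs e n v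
  proof (induction xs arbitrary: e n v)
    case (Cons c xs)
    have sound: "run (prog_of e') Or n' = Some v'" if "lmem (claim e' n' v') (list_encode xs)" for e' n' v'
    proof -
      have "trace Or (list_encode xs)"
        using Cons.prems(1) trace_Cons[of Or "pfst c" "pfst (psnd c)" "psnd (psnd c)"] by simp
      then show ?thesis using Cons.IH that lmem_encode by blast
    qed
    show ?case
    proof (cases "c = claim e n v")
      case False
      then show ?thesis using Cons.prems(2) sound lmem_encode by (metis set_ConsD)
    next
      case True
      then have j: "justified Or (list_encode xs) e n v" using Cons.prems(1) trace_Cons by blast
      define m where "m = (e - 5) div 4"
      have P: "prog_of e =
        (if (e - 5) mod 4 = 0 then Tuple (prog_of (pfst m)) (prog_of (psnd m))
         else if (e - 5) mod 4 = 1 then Comp (prog_of (pfst m)) (prog_of (psnd m))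
         else if (e - 5) mod 4 = 2 then Rec (prog_of (pfst m)) (prog_of (psnd m))
         else Min (prog_of m))" if "5 \<le> e"
        using that by (subst prog_of.simps) (simp add: m_def Let_def)
      from j show ?thesis unfolding justified_def m_def[symmetric]
      proof (elim disjE conjE exE)
        assume "5 \<le> e" "(e - 5) mod 4 = 0" "lmem (claim (pfst m) n (pfst v)) (list_encode xs)"
          "lmem (claim (psnd m) n (psnd v)) (list_encode xs)"
        then show ?thesis using P by (simp add: sound)
      next
        fix r assume "5 \<le> e" "(e - 5) mod 4 = 1" "lmem (claim (psnd m) n r) (list_encode xs)"
          "lmem (claim (pfst m) r v) (list_encode xs)"
        then show ?thesis using P by (simp add: sound)
      next
        assume "5 \<le> e" "(e - 5) mod 4 = 2" "psnd n = 0" "lmem (claim (pfst m) (pfst n) v) (list_encode xs)"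
        then show ?thesis using P by (simp add: sound case_prod_beta)
      next
        fix r assume *: "5 \<le> e" "(e - 5) mod 4 = 2" "psnd n \<noteq> 0"
          "lmem (claim e (pair (pfst n) (psnd n - 1)) r) (list_encode xs)"
          "lmem (claim (psnd m) (pair (pfst n) (pair (psnd n - 1) r)) v) (list_encode xs)"
        then obtain k where k: "psnd n = Suc k" using not0_implies_Suc by blast
        show ?thesis
          using P * sound[OF *(4)] sound[OF *(5)] by (simp add: k case_prod_beta)
      next
        assume *: "5 \<le> e" "(e - 5) mod 4 = 3" "lmem (claim m (pair n v) 0) (list_encode xs)"
          "\<forall>j<v. \<exists>r<list_encode xs. lmem (claim m (pair n j) (Suc r)) (list_encode xs)"
        let ?r = "run (prog_of m) Or"
        have v: "?r (pair n v) = Some 0" using sound[OF *(3)] .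
        have lt: "\<exists>r. ?r (pair n j) = Some (Suc r)" if "j < v" for j
          using that *(4) sound by blast
        have "(LEAST k. ?r (pair n k) = Some 0) = v"
        proof (rule Least_equality)
          fix k assume "?r (pair n k) = Some 0"
          then show "v \<le> k" using lt[of k] by (cases "k < v") auto
        qed (rule v)
        moreover have "\<exists>k. ?r (pair n k) = Some 0 \<and> (\<forall>j<k. ?r (pair n j) \<noteq> None)"
          using v lt by (intro exI[of _ v]) fastforce
        ultimately show ?thesis using P *(1,2) by simp
      qed (auto simp: prog_of_eqs prog_of_eqs(2)[unfolded One_nat_def])
    qed
  qed (simp add: trace_Nil)
  from this[of "list_decode w" e n v] show ?thesis
    using assms lmem_encode[of "claim e n v" "list_decode w"] by simp
qed

text \<open>The use principle: every argument in a claim of \<open>w\<close> is below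
  \<open>w\<close>, so no query reaches beyond. It lets a finite tree and a full solution exchange
  certificates.\<close>

lemma trace_cong:
  assumes "trace Or w" "\<And>n. n < w \<Longrightarrow> Or n = Or' n"
  shows "trace Or' w"
proof -
  have "justified Or' u e n v" if "justified Or u e n v" "n < w" for u e n v
    using that assms(2) unfolding justified_def by auto
  moreover have "pfst (psnd (lnth w i)) < w" if "i < w" "ldrop w i \<noteq> 0" for i
  proof -
    have "lmem (lnth w i) w" using that unfolding lmem_def by blast
    then have "lnth w i < w" using less_encode lmem_encode by (metis list_decode_inverse)
    moreover have "pfst (psnd (lnth w i)) \<le> lnth w i"
      using claim_le(2)[of "pfst (psnd (lnth w i))" "pfst (lnth w i)" "psnd (psnd (lnth w i))"] by simp
    ultimately show ?thesis by simp
  qed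
  ultimately show ?thesis using assms(1) unfolding trace_def by blast
qed

section \<open>The prefix order and order embeddings of the binary tree, on codes\<close>

section \<open>Strings as numbers\<close>

text \<open>The map \<open>(u - 1) div 2\<close> is the parent map and fixes the root. A string is
  no longer than its code, so the bound on \<open>j\<close> loses nothing and makes the relation
  decidable.\<close>

definition pre :: "nat \<Rightarrow> nat \<Rightarrow> bool" where
  "pre a b \<longleftrightarrow> (\<exists>j\<le>b. rec_nat b (\<lambda>_ u. (u - 1) div 2) j = a)"

text \<open>
  A map \<open>\<theta>\<close> on codes with \<open>pre (pos \<theta> j) (\<theta> j)\<close> for all \<open>j > 0\<close> sends the two successors of a
  node above the two immediate successors of its image, which makes it an order embedding.
\<close>

definition pos :: "(nat \<Rightarrow> nat) \<Rightarrow> nat \<Rightarrow> nat" where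
  "pos \<theta> j = 2 * \<theta> ((j - 1) div 2) + (if even j then 2 else 1)"

lemma rec_pre:
  assumes "rec_fun F" "rec_fun G"
  shows "rec_pred (\<lambda>X n. pre (F X n) (G X n))"
proof -
  have "rec_pred (\<lambda>X m. pre (pfst m) (psnd m))"
    unfolding pre_def by (intro rec_intros) simp_all
  from rec_pred_comp2[OF this assms] show ?thesis .
qed

lemma length_le_str_code: "length s \<le> str_code s"
  by (induction s rule: rev_induct) auto

lemma str_code_parent: "(str_code s - 1) div 2 = str_code (butlast s)"
  by (cases s rule: rev_cases) auto

lemma str_code_ancestor:
  "rec_nat (str_code s) (\<lambda>_ u. (u - 1) div 2) j = str_code (take (length s - j) s)"
proof (induction j)
  case (Suc j)
  have "butlast (take (length s - j) s) = take (length s - Suc j) s"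
    by (simp add: butlast_take)
  then show ?case using Suc by (simp only: str_code_parent nat.rec(2))
qed simp

lemma inj_str_code: "str_code s = str_code t \<longleftrightarrow> s = t"
  using bij_str_code by (simp add: bij_is_inj inj_eq)

lemma pre_str_code: "pre (str_code s) (str_code t) \<longleftrightarrow> prefix s t"
proof
  assume "pre (str_code s) (str_code t)"
  then show "prefix s t"
    unfolding pre_def str_code_ancestor inj_str_code by (metis take_is_prefix)
next
  assume p: "prefix s t"
  then have "take (length t - (length t - length s)) t = s"
    by (auto simp: prefix_def)
  then show "pre (str_code s) (str_code t)"
    unfolding pre_def str_code_ancestor inj_str_code
    using length_le_str_code[of t] by (intro exI[of _ "length t - length s"]) auto
qed

lemma str_code_cases: obtains s where "n = str_code s"
  using bij_str_code by (metis bij_pointE)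

lemma pre_refl: "pre a a"
  by (rule str_code_cases[of a]) (simp add: pre_str_code)

lemma pre_trans: "pre a b \<Longrightarrow> pre b c \<Longrightarrow> pre a c"
  by (rule str_code_cases[of a], rule str_code_cases[of b], rule str_code_cases[of c])
    (auto simp: pre_str_code intro: prefix_order.trans)

lemma pre_child: "pre a (2 * a + (if b then 2 else 1))"
  by (rule str_code_cases[of a]) (metis pre_str_code prefixI str_code_snoc)

lemma pre_le: "pre a b \<Longrightarrow> a \<le> b"
proof -
  have "rec_nat b (\<lambda>_ u. (u - 1) div 2) j \<le> b" for j
    by (induction j) (auto intro: order.trans[rotated])
  then show "pre a b \<Longrightarrow> a \<le> b" unfolding pre_def by blast
qed

lemma pre_pos: "pre (\<theta> ((j - 1) div 2)) (pos \<theta> j)"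
  unfolding pos_def by (rule pre_child)

lemma pre_large: "\<exists>b\<ge>n. pre a b"
proof (induction n)
  case (Suc n)
  then obtain b where "b \<ge> n" "pre a b" by blast
  moreover have "pre b (2 * b + 1)" using pre_child[of b False] by simp
  ultimately show ?case by (intro exI[of _ "2 * b + 1"]) (auto intro: pre_trans)
qed (use pre_refl in blast)

text \<open>Ensures that finitely many images determine the range below a given bound. Each image is
  at least a successor of the image of the parent, hence the induction.\<close>

lemma embedding_ge:
  assumes "\<And>j. 0 < j \<Longrightarrow> pre (pos \<theta> j) (\<theta> j)"
  shows "j \<le> \<theta> j"
proof (induction j rule: less_induct)
  case (less j)
  show ?case
  proof (cases "j = 0")
    case False
    then have "(j - 1) div 2 \<le> \<theta> ((j - 1) div 2)" by (intro less) linarith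
    then have "j \<le> pos \<theta> j" unfolding pos_def using False by presburger
    then show ?thesis using pre_le[OF assms] False by (meson bot_nat_0.not_eq_extremum order.trans)
  qed simp
qed

text \<open>Order is reflected as well as preserved: incomparable nodes pass through different
  successors of a common node, and their images pass through different successors of its
  image.\<close>

lemma iso_full_tree_embedding:
  assumes emb: "\<And>j. 0 < j \<Longrightarrow> pre (pos \<theta> j) (\<theta> j)"
  shows "iso_full_tree {s. str_code s \<in> range \<theta>}"
proof -
  define h where "h s = (SOME t. str_code t = \<theta> (str_code s))" for s
  have h: "str_code (h s) = \<theta> (str_code s)" for s
    unfolding h_def by (rule someI_ex) (metis str_code_cases)
  have step: "prefix (h r @ [b]) (h (r @ [b]))" for r b
  proof -
    have "pos \<theta> (str_code (r @ [b])) = str_code (h r @ [b])"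
      by (cases b) (simp_all add: pos_def h)
    then show ?thesis using emb[of "str_code (r @ [b])"] by (simp flip: pre_str_code add: h)
  qed
  have ext: "prefix (h r) (h (r @ q))" for r q
  proof (induction q rule: rev_induct)
    case (snoc b q)
    then show ?case
      using step[of "r @ q" b] by (metis append_assoc prefix_order.trans prefixI)
  qed simp
  have ext': "prefix (h r @ [b]) (h (r @ b # q))" for r b q
    using step[of r b] ext[of "r @ [b]" q]
    by (metis append_Cons append_Nil append_assoc prefix_order.trans)
  have mono: "prefix (h q) (h r) \<longleftrightarrow> prefix q r" for q r
  proof
    assume "prefix q r"
    then show "prefix (h q) (h r)" using ext by (auto simp: prefix_def)
  next
    assume p: "prefix (h q) (h r)"
    show "prefix q r"
    proof (rule ccontr)
      assume "\<not> prefix q r"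
      then consider (a) "strict_prefix r q" | (b) "parallel q r"
        unfolding parallel_def prefix_order.le_less by blast
      then show False
      proof cases
        case a
        then obtain b u where "q = r @ b # u" by (auto elim: strict_prefixE')
        then have "prefix (h r @ [b]) (h r)" using ext' p prefix_order.trans by blast
        then show False by (simp add: prefix_def)
      next
        case b
        obtain as x y xs ys where "x \<noteq> y" "q = as @ x # xs" "r = as @ y # ys"
          using parallel_decomp[OF b] by blast
        moreover have "prefix (h as @ [x]) (h r)"
          using ext'[of as x xs] p unfolding \<open>q = _\<close> by (rule prefix_order.trans)
        moreover have "prefix (h as @ [y]) (h r)"
          using ext'[of as y ys] unfolding \<open>r = _\<close> .
        ultimately show False by (auto simp: prefix_def)
      qed
    qed
  qed
  have "inj h" by (rule injI) (metis mono prefix_order.order_antisym prefix_order.refl)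
  moreover have "range h = {s. str_code s \<in> range \<theta>}"
  proof (intro equalityI subsetI)
    fix s assume "s \<in> {s. str_code s \<in> range \<theta>}"
    then obtain j where "str_code s = \<theta> j" by blast
    moreover obtain t where "j = str_code t" by (rule str_code_cases)
    ultimately have "s = h t" using h inj_str_code by metis
    then show "s \<in> range h" by blast
  qed (auto simp: h)
  ultimately show ?thesis unfolding iso_full_tree_def using mono by (auto simp: bij_betw_def)
qed

section \<open>Extending finite monochromatic trees to full ones\<close>

section \<open>Somewhere dense colours\<close>

definition dense :: "(nat \<Rightarrow> nat) \<Rightarrow> nat \<Rightarrow> nat \<Rightarrow> bool" where
  "dense f c t \<longleftrightarrow> (\<forall>r. pre t r \<longrightarrow> (\<exists>r'. pre r r' \<and> f r' = c))"

definition sdense :: "(nat \<Rightarrow> nat) \<Rightarrow> nat \<Rightarrow> nat \<Rightarrow> bool" where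
  "sdense f c y \<longleftrightarrow> (\<exists>t. pre y t \<and> dense f c t)"

lemma dense_pre: "dense f c t \<Longrightarrow> pre t u \<Longrightarrow> dense f c u"
  unfolding dense_def by (meson pre_trans)

lemma sdense_pre: "sdense f c z \<Longrightarrow> pre y z \<Longrightarrow> sdense f c y"
  unfolding sdense_def by (meson pre_trans)

lemma dense_imp_sdense: "dense f c t \<Longrightarrow> sdense f c t"
  unfolding sdense_def using pre_refl by blast

lemma sdense_range: "sdense f c y \<Longrightarrow> c \<in> range f"
  unfolding sdense_def dense_def using pre_refl by blast

text \<open>Climbing first to a large node of the cone in which \<open>c\<close> is dense pushes
  \<open>u\<close> past any bound \<open>w\<close>.\<close>

lemma sdense_extend:
  assumes "sdense f c z"
  shows "\<exists>u. pre z u \<and> f u = c \<and> w < u \<and> dense f c u"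
proof -
  obtain t where t: "pre z t" "dense f c t" using assms unfolding sdense_def by blast
  obtain b where b: "b \<ge> Suc w" "pre t b" using pre_large by blast
  then obtain u where u: "pre b u" "f u = c" using t unfolding dense_def by blast
  have "w < u" using b pre_le[OF u(1)] by simp
  moreover have "pre t u" using b(2) u(1) by (rule pre_trans)
  ultimately show ?thesis using t u by (intro exI[of _ u]) (auto intro: pre_trans dense_pre)
qed

function extend :: "(nat \<Rightarrow> nat) \<Rightarrow> nat \<Rightarrow> (nat \<Rightarrow> nat) \<Rightarrow> nat \<Rightarrow> nat" where
  "extend \<theta> n g j = (if j < n \<or> j = 0 then \<theta> j
     else g (2 * extend \<theta> n g ((j - 1) div 2) + (if even j then 2 else 1)))"
  by pat_completeness auto
termination by (relation "measure (\<lambda>(\<theta>, n, g, j). j)") auto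

declare extend.simps [simp del]

text \<open>The indices from \<open>n\<close> to \<open>2 * n\<close> are exactly the children of
  the first \<open>n\<close> nodes that are not among these nodes. Each new node is chosen with
  \<open>c\<close> dense above it, so the choice can be repeated at its successors; all new nodes
  exceed \<open>w\<close>, so nothing changes up to \<open>w\<close>.\<close>

lemma extend_embedding:
  assumes n: "0 < n"
    and emb: "\<And>j. 0 < j \<Longrightarrow> j < n \<Longrightarrow> pre (pos \<theta> j) (\<theta> j)"
    and col: "\<And>j. j < n \<Longrightarrow> f (\<theta> j) = c"
    and leaves: "\<And>j. n \<le> j \<Longrightarrow> j \<le> 2 * n \<Longrightarrow> sdense f c (pos \<theta> j)"
  shows "\<exists>\<theta>'. (\<forall>j<n. \<theta>' j = \<theta> j) \<and> (\<forall>j>0. pre (pos \<theta>' j) (\<theta>' j)) \<and> (\<forall>j. f (\<theta>' j) = c) \<and>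
    (\<forall>j\<ge>n. w < \<theta>' j)"
proof -
  have "\<forall>z. \<exists>u. sdense f c z \<longrightarrow> pre z u \<and> f u = c \<and> w < u \<and> dense f c u"
    using sdense_extend by blast
  then obtain g where "\<forall>z. sdense f c z \<longrightarrow> pre z (g z) \<and> f (g z) = c \<and> w < g z \<and> dense f c (g z)"
    by (rule choice[THEN exE])
  then have g: "\<And>z. sdense f c z \<Longrightarrow> pre z (g z) \<and> f (g z) = c \<and> w < g z \<and> dense f c (g z)"
    by simp
  define \<theta>' where "\<theta>' = extend \<theta> n g"
  have lo: "\<theta>' j = \<theta> j" if "j < n" for j
    using that unfolding \<theta>'_def by (subst extend.simps) simp
  have hi: "\<theta>' j = g (pos \<theta>' j)" if "n \<le> j" for j
    using that n by (subst \<theta>'_def, subst extend.simps) (simp add: pos_def \<theta>'_def)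
  have sd: "sdense f c (pos \<theta>' j)" if "n \<le> j" for j
    using that
  proof (induction j rule: less_induct)
    case (less j)
    let ?i = "(j - 1) div 2"
    show ?case
    proof (cases "?i < n")
      case True
      then have "pos \<theta>' j = pos \<theta> j" by (simp add: pos_def lo)
      moreover have "j \<le> 2 * n" using True by linarith
      ultimately show ?thesis using leaves less.prems by simp
    next
      case False
      moreover have "?i < j" using less.prems n by linarith
      ultimately have "sdense f c (pos \<theta>' ?i)" using less.IH[of ?i] by simp
      then have "dense f c (\<theta>' ?i)" using g hi[of ?i] False by simp
      from dense_imp_sdense[OF dense_pre[OF this pre_pos[of \<theta>' j]]] show ?thesis .
    qed
  qed
  have "pre (pos \<theta>' j) (\<theta>' j)" if "0 < j" for j
  proof (cases "j < n")
    case True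
    moreover have "(j - 1) div 2 < n" using True by linarith
    ultimately show ?thesis using emb[OF that] by (simp add: pos_def lo)
  next
    case False
    then show ?thesis using g[OF sd, of j] hi[of j] by simp
  qed
  moreover have "f (\<theta>' j) = c" for j
    using col[of j] g[OF sd, of j] hi[of j] lo[of j] by (cases "j < n") auto
  moreover have "w < \<theta>' j" if "n \<le> j" for j
    using g[OF sd[OF that]] hi[OF that] by simp
  ultimately show ?thesis using lo by (intro exI[of _ \<theta>']) simp
qed

lemma sdense_embedding:
  assumes "sdense f c y"
  shows "\<exists>\<theta>. pre y (\<theta> 0) \<and> (\<forall>j>0. pre (pos \<theta> j) (\<theta> j)) \<and> (\<forall>j. f (\<theta> j) = c)"
proof -
  obtain u where u: "pre y u" "f u = c" "dense f c u" using sdense_extend[OF assms] by blast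
  \<comment> \<open>The one-node tree \<open>u\<close> is extended; its leaves are the two
    successors of \<open>u\<close>, above which \<open>c\<close> is dense.\<close>
  have "\<exists>\<theta>'. (\<forall>j<1. \<theta>' j = u) \<and> (\<forall>j>0. pre (pos \<theta>' j) (\<theta>' j)) \<and> (\<forall>j. f (\<theta>' j) = c) \<and>
    (\<forall>j\<ge>1. 0 < \<theta>' j)"
    using u dense_imp_sdense[OF dense_pre[OF u(3) pre_pos[of "\<lambda>_. u"]]]
    by (intro extend_embedding) auto
  then obtain \<theta> where "\<theta> 0 = u" "\<forall>j>0. pre (pos \<theta> j) (\<theta> j)" "\<forall>j. f (\<theta> j) = c"
    by (metis less_one)
  then show ?thesis using u(1) by (intro exI[of _ \<theta>]) simp
qed

section \<open>Stagewise approximation of the colours above a node\<close>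

section \<open>Guessing a somewhere dense colour\<close>

definition reach :: "(nat \<Rightarrow> nat \<Rightarrow> nat \<Rightarrow> bool) \<Rightarrow> nat \<Rightarrow> nat \<Rightarrow> nat \<Rightarrow> bool" where
  "reach V s t c \<longleftrightarrow> (\<exists>r\<le>s. pre t r \<and> V s r c)"

text \<open>Nonemptiness keeps the scan away from nodes above which no colour has been seen yet;
  their empty sets would otherwise count as smaller.\<close>

definition shrinks :: "(nat \<Rightarrow> nat \<Rightarrow> nat \<Rightarrow> bool) \<Rightarrow> nat \<Rightarrow> nat \<Rightarrow> nat \<Rightarrow> bool" where
  "shrinks V s t u \<longleftrightarrow> (\<exists>c\<le>s. reach V s t c) \<and> (\<forall>c\<le>s. reach V s t c \<longrightarrow> reach V s u c) \<and>
     (\<exists>c\<le>s. reach V s u c \<and> \<not> reach V s t c)"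

text \<open>
  Read \<open>V s n c\<close> as ``by stage \<open>s\<close> the node \<open>n\<close> is seen to have colour \<open>c\<close>''. Nodes above \<open>y\<close> are
  scanned in order of their codes, moving whenever the set of colours seen above the node gets
  strictly smaller. The true colour sets stabilise along the scan at a node above which all
  remaining colours are dense; later, spurious moves at stage \<open>s\<close> only shrink the set further.
\<close>

definition cur :: "(nat \<Rightarrow> nat \<Rightarrow> nat \<Rightarrow> bool) \<Rightarrow> nat \<Rightarrow> nat \<Rightarrow> nat \<Rightarrow> nat" where
  "cur V s y n = rec_nat y (\<lambda>i u. if pre y i \<and> shrinks V s i u then i else u) n"

definition guess :: "(nat \<Rightarrow> nat \<Rightarrow> nat \<Rightarrow> bool) \<Rightarrow> nat \<Rightarrow> nat \<Rightarrow> nat" where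
  "guess V s y = bleast (reach V s (cur V s y (Suc s))) (Suc s)"

locale approx_colouring =
  fixes f :: "nat \<Rightarrow> nat" and V :: "nat \<Rightarrow> nat \<Rightarrow> nat \<Rightarrow> bool"
  assumes fin: "finite (range f)"
    and sound: "V s n c \<Longrightarrow> f n = c"
    and complete: "\<exists>s. V s n (f n)"
    and V_mono: "V s n c \<Longrightarrow> s \<le> s' \<Longrightarrow> V s' n c"
    and V_le: "V s n c \<Longrightarrow> c \<le> s"
begin

abbreviation Rs where "Rs s t \<equiv> {c. reach V s t c}"
abbreviation R where "R t \<equiv> f ` {r. pre t r}"

lemma R_antimono: "pre t u \<Longrightarrow> R u \<subseteq> R t"
  using pre_trans by blast

lemma finite_R: "finite (R t)"
  using fin by (rule finite_subset[rotated]) blast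

lemma reach_le: "reach V s t c \<Longrightarrow> c \<le> s"
  unfolding reach_def using V_le by blast

lemma shrinks_iff: "shrinks V s t u \<longleftrightarrow> Rs s t \<noteq> {} \<and> Rs s t \<subset> Rs s u"
  unfolding shrinks_def using reach_le by blast

lemma Rs_eventually: "\<forall>\<^sub>F s in sequentially. Rs s t = R t"
proof -
  have "\<forall>\<^sub>F s in sequentially. reach V s t c" if "c \<in> R t" for c
  proof -
    from that obtain r where r: "pre t r" "f r = c" by auto
    then obtain s0 where "V s0 r c" using complete by blast
    then have "reach V s t c" if "s \<ge> max s0 r" for s
      unfolding reach_def using r V_mono that by auto
    then show ?thesis unfolding eventually_sequentially by blast
  qed
  then have "\<forall>\<^sub>F s in sequentially. \<forall>c\<in>R t. reach V s t c"
    by (intro eventually_ball_finite[OF finite_R] ballI)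
  moreover have "Rs s t \<subseteq> R t" for s unfolding reach_def using sound by blast
  ultimately show ?thesis by (elim eventually_mono) blast
qed

text \<open>The limit of \<open>cur\<close> as the stage grows: the same scan with the true colour
  sets.\<close>

definition lcur :: "nat \<Rightarrow> nat \<Rightarrow> nat" where
  "lcur y n = rec_nat y (\<lambda>i u. if pre y i \<and> R i \<subset> R u then i else u) n"

lemma lcur_Suc: "lcur y (Suc n) = (if pre y n \<and> R n \<subset> R (lcur y n) then n else lcur y n)"
  by (simp add: lcur_def)

lemma cur_Suc: "cur V s y (Suc n) = (if pre y n \<and> shrinks V s n (cur V s y n) then n else cur V s y n)"
  by (simp add: cur_def)

lemma cur_eventually: "\<forall>\<^sub>F s in sequentially. cur V s y n = lcur y n"
proof (induction n)
  case 0
  then show ?case by (simp add: cur_def lcur_def)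
next
  case (Suc n)
  from Suc Rs_eventually[of n] Rs_eventually[of "lcur y n"] show ?case
  proof eventually_elim
    case (elim s)
    have "R n \<noteq> {}" using pre_refl by blast
    then show ?case unfolding cur_Suc lcur_Suc shrinks_iff elim by simp
  qed
qed

lemma pre_lcur: "pre y (lcur y n)"
  by (induction n) (simp_all add: lcur_Suc pre_refl, simp add: lcur_def pre_refl)

lemma guess_eventually: "\<forall>\<^sub>F s in sequentially. sdense f (guess V s y) y"
proof -
  have anti: "n \<le> n' \<Longrightarrow> R (lcur y n') \<subseteq> R (lcur y n)" for n n'
  proof (induction n' rule: dec_induct)
    case (step n')
    have "R (lcur y (Suc n')) \<subseteq> R (lcur y n')"
      unfolding lcur_Suc by (cases "R n' \<subset> R (lcur y n')") auto
    then show ?case using step.IH by (rule order.trans)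
  qed simp
  \<comment> \<open>The colour sets along the limit scan decrease; from \<open>n0\<close> on they
    have least size and are constant.\<close>
  obtain n0 where n0: "\<And>n. card (R (lcur y n0)) \<le> card (R (lcur y n))"
    using ex_has_least_nat[of "\<lambda>_. True" 0 "\<lambda>n. card (R (lcur y n))"] by auto
  have const: "R (lcur y n) = R (lcur y n0)" if "n0 \<le> n" for n
    using card_seteq[OF finite_R anti[OF that] n0] .
  define t0 where "t0 = lcur y n0"
  have dense: "dense f c t0" if c: "c \<in> R t0" for c
    unfolding dense_def
  proof (intro allI impI)
    fix r assume r: "pre t0 r"
    \<comment> \<open>A node above \<open>r\<close> scanned only after the sets have settled: a
      smaller colour set there would have caused another move.\<close>
    obtain r' where r': "r' \<ge> n0" "pre r r'" using pre_large by blast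
    then have p: "pre t0 r'" "pre y r'" using r pre_lcur pre_trans unfolding t0_def by blast+
    have "\<not> R r' \<subset> R t0"
      using const[of "Suc r'"] const[of r'] r' p(2) by (auto simp: lcur_Suc t0_def split: if_splits)
    then have "R r' = R t0" using R_antimono[OF p(1)] by blast
    with c have "c \<in> R r'" by simp
    then obtain r'' where "pre r' r''" "f r'' = c" by auto
    then show "\<exists>r'. pre r r' \<and> f r' = c" using pre_trans[OF r'(2)] by blast
  qed
  from cur_eventually[of y n0] Rs_eventually[of t0] eventually_ge_at_top[of n0]
  show ?thesis
  proof eventually_elim
    case (elim s)
    \<comment> \<open>After \<open>n0\<close> the scan at stage \<open>s\<close> may leave the limit
      scan, but each move only shrinks the nonempty set of colours seen, so the guess is still a
      colour dense above \<open>t0\<close>.\<close>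
    have "Rs s (cur V s y n) \<noteq> {} \<and> Rs s (cur V s y n) \<subseteq> R t0" if "n0 \<le> n" for n
      using that
    proof (induction n rule: dec_induct)
      case base
      have "R t0 \<noteq> {}" using pre_refl by blast
      then show ?case using elim by (simp add: t0_def)
    next
      case (step n)
      then show ?case unfolding cur_Suc shrinks_iff by auto
    qed
    from this[of "Suc s"] elim(3) obtain c where c: "reach V s (cur V s y (Suc s)) c"
      and sub: "Rs s (cur V s y (Suc s)) \<subseteq> R t0"
      by auto
    have "c < Suc s" using reach_le[OF c] by simp
    then have "guess V s y < Suc s"
      unfolding guess_def using bleast_bound[of _ c] c by (meson le_less_trans)
    then have "reach V s (cur V s y (Suc s)) (guess V s y)"
      unfolding guess_def by (rule bleast_holds)
    then have "dense f (guess V s y) t0" using sub dense by blast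
    then show ?case unfolding sdense_def t0_def using pre_lcur by blast
  qed
qed

end

section \<open>Bounded selection of a candidate whose leaves all admit its colour\<close>

section \<open>Selecting an extendible candidate\<close>

definition pick :: "(nat \<Rightarrow> nat \<Rightarrow> nat \<Rightarrow> bool) \<Rightarrow> (nat \<Rightarrow> nat) \<Rightarrow> (nat \<Rightarrow> nat \<Rightarrow> nat \<Rightarrow> bool) \<Rightarrow> nat \<Rightarrow> nat \<Rightarrow> nat"
  where "pick K colour V s y = bleast (\<lambda>q. K s y q \<and> colour q = guess V s y) (Suc s)"

locale candidates = approx_colouring +
  fixes K :: "nat \<Rightarrow> nat \<Rightarrow> nat \<Rightarrow> bool" and colour :: "nat \<Rightarrow> nat" and leaves :: "nat \<Rightarrow> nat set"
  assumes finite_leaves: "finite (leaves q)"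
    and leaf_above: "K s y q \<Longrightarrow> z \<in> leaves q \<Longrightarrow> pre y z"
    and candidate_exists: "sdense f c y \<Longrightarrow> \<exists>q. colour q = c \<and> (\<forall>\<^sub>F s in sequentially. K s y q)"
begin

abbreviation pk where "pk \<equiv> pick K colour V"
abbreviation gs where "gs \<equiv> guess V"

text \<open>The number \<open>t\<close> codes a pair \<open>(N, z)\<close> and has two roles: its
  second component is the node, and \<open>t\<close> itself, being at least \<open>N\<close>, bounds
  the nodes consulted. The first conjunct tests that the search for a candidate succeeded.\<close>

definition acc :: "nat \<Rightarrow> nat \<Rightarrow> bool" where
  "acc s t \<longleftrightarrow> pk s (psnd t) \<le> s \<and>
     (\<forall>z\<in>leaves (pk s (psnd t)). \<exists>z'\<le>t. pre z z' \<and> gs s z' = gs s (psnd t))"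

text \<open>The guess need not converge, but it eventually stays among the finitely many somewhere
  dense colours. One candidate for each of them gives the bound \<open>b\<close>.\<close>

lemma pick_eventually:
  "\<exists>b. \<forall>\<^sub>F s in sequentially. pk s y \<le> b \<and> pk s y \<le> s \<and> K s y (pk s y) \<and>
     colour (pk s y) = gs s y \<and> sdense f (gs s y) y"
proof -
  obtain q where q: "\<And>c. sdense f c y \<Longrightarrow> colour (q c) = c \<and> (\<forall>\<^sub>F s in sequentially. K s y (q c))"
    using candidate_exists[of _ y] by metis
  let ?C = "{c. sdense f c y}"
  have fC: "finite ?C" using fin by (rule finite_subset[rotated]) (auto dest: sdense_range)
  define b where "b = (\<Sum>c\<in>?C. q c)"
  have b: "q c \<le> b" if "sdense f c y" for c
    unfolding b_def using that fC by (intro member_le_sum) auto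
  have "\<forall>\<^sub>F s in sequentially. \<forall>c\<in>?C. K s y (q c)"
    using q by (intro eventually_ball_finite[OF fC]) blast
  from this guess_eventually[of y] eventually_ge_at_top[of b]
  have "\<forall>\<^sub>F s in sequentially. pk s y \<le> b \<and> pk s y \<le> s \<and> K s y (pk s y) \<and>
     colour (pk s y) = gs s y \<and> sdense f (gs s y) y"
  proof eventually_elim
    case (elim s)
    let ?q = "q (gs s y)"
    have k: "K s y ?q" "colour ?q = gs s y" using elim(1,2) q by auto
    have "?q \<le> b" using b elim(2) by simp
    then have "?q < Suc s" using elim(3) by simp
    then have le: "pk s y \<le> ?q" unfolding pick_def using k by (intro bleast_bound) auto
    then have "pk s y < Suc s" using \<open>?q < Suc s\<close> by simp
    then have "K s y (pk s y) \<and> colour (pk s y) = gs s y" unfolding pick_def by (rule bleast_holds)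
    then show ?case using le \<open>?q \<le> b\<close> \<open>pk s y < Suc s\<close> elim(2) by simp
  qed
  then show ?thesis by blast
qed

text \<open>
  If \<open>acc s (pair N z)\<close> fails for all \<open>z \<le> N\<close>, each picked candidate has a leaf above which its colour
  is never guessed; passing to that leaf, and repeating, uses up a new colour each time. As only
  boundedly many nodes are met on the way, \<open>N\<close> can be chosen independently of \<open>s\<close>, and so all
  guesses involved are eventually correct.
\<close>

lemma selection:
  "\<exists>B. \<forall>\<^sub>F s in sequentially. \<exists>y q. y = psnd (bleast (acc s) (Suc s)) \<and> q = pk s y \<and> q \<le> B \<and>
     K s y q \<and> (\<forall>z\<in>leaves q. sdense f (colour q) z)"
proof -
  have "\<forall>y. \<exists>b. \<forall>\<^sub>F s in sequentially. pk s y \<le> b \<and> pk s y \<le> s \<and> K s y (pk s y) \<and>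
     colour (pk s y) = gs s y \<and> sdense f (gs s y) y"
    using pick_eventually by (rule allI)
  then obtain b where b: "\<forall>y. \<forall>\<^sub>F s in sequentially. pk s y \<le> b y \<and> pk s y \<le> s \<and> K s y (pk s y) \<and>
     colour (pk s y) = gs s y \<and> sdense f (gs s y) y"
    by (rule choice[THEN exE])
  have "\<forall>N. \<exists>l. \<forall>y\<le>N. \<forall>q\<le>b y. \<forall>z\<in>leaves q. z \<le> l"
  proof
    fix N
    have "finite (\<Union>y\<in>{..N}. \<Union>q\<in>{..b y}. leaves q)" using finite_leaves by auto
    then obtain l where "\<forall>z\<in>(\<Union>y\<in>{..N}. \<Union>q\<in>{..b y}. leaves q). z \<le> l"
      using finite_nat_set_iff_bounded_le by blast
    then show "\<exists>l. \<forall>y\<le>N. \<forall>q\<le>b y. \<forall>z\<in>leaves q. z \<le> l" by auto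
  qed
  then obtain l where "\<forall>N. \<forall>y\<le>N. \<forall>q\<le>b y. \<forall>z\<in>leaves q. z \<le> l N"
    by (rule choice[THEN exE])
  then have l: "\<And>N y q z. y \<le> N \<Longrightarrow> q \<le> b y \<Longrightarrow> z \<in> leaves q \<Longrightarrow> z \<le> l N"
    by blast
  \<comment> \<open>\<open>M j\<close> bounds the node reached after \<open>j\<close> passages to a
    bad leaf, at every stage where the picks involved obey their bounds \<open>b\<close>.\<close>
  define M where "M = rec_nat 0 (\<lambda>_ m. max m (l m))"
  have M_Suc: "M (Suc j) = max (M j) (l (M j))" for j by (simp add: M_def)
  have M_mono: "i \<le> j \<Longrightarrow> M i \<le> M j" for i j
    by (induction j rule: dec_induct) (auto simp: M_Suc)
  \<comment> \<open>One more than the number of colours, so that \<open>k\<close> excluded colours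
    are impossible.\<close>
  define k where "k = Suc (card (range f))"
  define N where "N = M k"
  \<comment> \<open>A common bound for all codes \<open>pair N z\<close> with \<open>z\<close> at
    most \<open>N\<close>; the guesses and picks at all nodes up to \<open>t0\<close> are eventually
    correct simultaneously.\<close>
  define t0 where "t0 = (\<Sum>z\<le>N. pair N z)"
  have t0: "pair N z \<le> t0" if "z \<le> N" for z
    unfolding t0_def using that by (intro member_le_sum) auto
  define B where "B = (\<Sum>y\<le>t0. b y)"
  have B: "b y \<le> B" if "y \<le> t0" for y
    unfolding B_def using that by (intro member_le_sum) auto
  have "\<forall>\<^sub>F s in sequentially. \<forall>y\<in>{..t0}. pk s y \<le> b y \<and> pk s y \<le> s \<and> K s y (pk s y) \<and>
     colour (pk s y) = gs s y \<and> sdense f (gs s y) y"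
    using b by (intro eventually_ball_finite) auto
  from this eventually_ge_at_top[of t0]
  have "\<forall>\<^sub>F s in sequentially. \<exists>y q. y = psnd (bleast (acc s) (Suc s)) \<and> q = pk s y \<and> q \<le> B \<and>
     K s y q \<and> (\<forall>z\<in>leaves q. sdense f (colour q) z)"
  proof eventually_elim
    case (elim s)
    have N_t0: "N \<le> t0" using t0[of N] le_prod_encode_1[of N N] by simp
    have pk: "pk s y \<le> b y" "pk s y \<le> s" "K s y (pk s y)" "colour (pk s y) = gs s y"
      "sdense f (gs s y) y" if "y \<le> t0" for y
      using elim(1) that by auto
    have "\<exists>z\<le>N. acc s (pair N z)"
    proof (rule ccontr)
      assume no: "\<not> (\<exists>z\<le>N. acc s (pair N z))"
      \<comment> \<open>\<open>C\<close> holds the colours excluded so far, never guessed above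
        \<open>z\<close> at nodes up to \<open>N\<close>. Since \<open>z\<close> is such a node
        itself, its own guess is a new colour.\<close>
      have "\<exists>z C. z \<le> M j \<and> C \<subseteq> range f \<and> card C = j \<and> (\<forall>z'\<le>N. pre z z' \<longrightarrow> gs s z' \<notin> C)"
        if "j \<le> k" for j
        using that
      proof (induction j)
        case (Suc j)
        then obtain z C where z: "z \<le> M j" "C \<subseteq> range f" "card C = j"
          "\<forall>z'\<le>N. pre z z' \<longrightarrow> gs s z' \<notin> C" by auto
        have zN: "z \<le> N" using z(1) M_mono[of j k] Suc.prems unfolding N_def by linarith
        then have zt: "z \<le> t0" using N_t0 by simp
        have "\<not> acc s (pair N z)" using no zN by blast
        then obtain z' where z': "z' \<in> leaves (pk s z)"
          "\<forall>z''\<le>pair N z. pre z' z'' \<longrightarrow> gs s z'' \<noteq> gs s z"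
          unfolding acc_def using pk(2)[OF zt] by auto
        have "pre z z'" using leaf_above pk(3)[OF zt] z'(1) by blast
        have "z' \<le> M (Suc j)" using l[OF z(1) pk(1)[OF zt] z'(1)] by (simp add: M_Suc)
        moreover have "gs s z \<notin> C" using z(4) zN pre_refl by blast
        then have "card (insert (gs s z) C) = Suc j"
          using z(2,3) finite_subset[OF z(2) fin] by simp
        moreover have "insert (gs s z) C \<subseteq> range f"
          using z(2) sdense_range[OF pk(5)[OF zt]] by simp
        moreover have "gs s z'' \<notin> insert (gs s z) C" if "z'' \<le> N" "pre z' z''" for z''
          using that z'(2) z(4) pre_trans[OF \<open>pre z z'\<close>] le_prod_encode_1[of N z] by auto
        ultimately show ?case by blast
      qed (intro exI[of _ 0] exI[of _ "{}"], simp)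
      from this[of k] obtain C where C: "C \<subseteq> range f" "card C = k" by blast
      from card_mono[OF fin C(1)] show False using C(2) k_def by simp
    qed
    then obtain z where z: "z \<le> N" "acc s (pair N z)" by blast
    define t where "t = bleast (acc s) (Suc s)"
    have "pair N z < Suc s" using t0[OF z(1)] elim(2) by simp
    then have "t \<le> pair N z" unfolding t_def using z(2) by (intro bleast_bound)
    then have t: "t \<le> t0" "t < Suc s" using t0[OF z(1)] \<open>pair N z < Suc s\<close> by simp_all
    have a: "acc s t" using t(2) unfolding t_def by (rule bleast_holds)
    define y where "y = psnd t"
    have "y \<le> t" unfolding y_def
      by (metis le_prod_encode_2 prod.collapse prod_decode_inverse)
    then have y: "y \<le> t0" using t by simp
    have "sdense f (colour (pk s y)) x" if "x \<in> leaves (pk s y)" for x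
    proof -
      \<comment> \<open>The witness of acceptance lies below \<open>t0\<close>, so the guess there
        is somewhere dense above it and hence above the leaf.\<close>
      obtain z' where z': "z' \<le> t" "pre x z'" "gs s z' = gs s y"
        using a \<open>x \<in> _\<close> unfolding acc_def y_def by blast
      then have "sdense f (gs s y) z'" using pk(5)[of z'] t by simp
      then show ?thesis using sdense_pre z'(2) pk(4)[OF y] by simp
    qed
    then show ?case using pk(1,3)[OF y] B[OF y] unfolding t_def[symmetric] y_def[symmetric]
      by (meson order.trans)
  qed
  then show ?thesis by blast
qed

end

section \<open>Candidates for an instance and the computable forward functional\<close>

section \<open>The reduction\<close>

text \<open>
  A candidate codes \<open>(c, n, L, w, v)\<close>: the first \<open>n\<close> entries of the list \<open>L\<close> are the images of the nodes
  \<open>0, \<dots>, n - 1\<close> under a partial embedding of colour \<open>c\<close>, and \<open>w\<close> certifies that the second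
  functional of the triple \<open>x\<close> gives the value \<open>v\<close> on this finite set.
\<close>

definition val :: "(nat \<Rightarrow> nat) \<Rightarrow> nat \<Rightarrow> nat \<Rightarrow> nat \<Rightarrow> bool" where
  "val x s n c \<longleftrightarrow> (\<exists>w\<le>s. trace (\<lambda>k. x (k + 2)) w \<and> lmem (claim (x 0) n c) w)"

abbreviation cand_len :: "nat \<Rightarrow> nat" where "cand_len q \<equiv> pfst (psnd q)"
abbreviation cand_node :: "nat \<Rightarrow> nat \<Rightarrow> nat" where "cand_node q \<equiv> lnth (pfst (psnd (psnd q)))"
abbreviation cand_trace :: "nat \<Rightarrow> nat" where "cand_trace q \<equiv> pfst (psnd (psnd (psnd q)))"
abbreviation cand_value :: "nat \<Rightarrow> nat" where "cand_value q \<equiv> psnd (psnd (psnd (psnd q)))"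

definition cand_set :: "nat \<Rightarrow> nat \<Rightarrow> nat" where
  "cand_set q k = (if \<exists>j<cand_len q. cand_node q j = k then 1 else 0)"

definition cand_oracle :: "(nat \<Rightarrow> nat) \<Rightarrow> nat \<Rightarrow> nat \<Rightarrow> nat" where
  "cand_oracle x q = join (\<lambda>k. x (k + 2)) (cand_set q)"

text \<open>Decidable, the stage serving only to bound the certificates for the colours. A candidate
  need not extend to a solution; that depends on its leaves.\<close>

definition cand :: "(nat \<Rightarrow> nat) \<Rightarrow> nat \<Rightarrow> nat \<Rightarrow> nat \<Rightarrow> bool" where
  "cand x s y q \<longleftrightarrow> 0 < cand_len q \<and> pre y (cand_node q 0) \<and>
     (\<forall>j<cand_len q. 0 < j \<longrightarrow> pre (pos (cand_node q) j) (cand_node q j)) \<and>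
     (\<forall>j<cand_len q. val x s (cand_node q j) (pfst q)) \<and>
     trace (cand_oracle x q) (cand_trace q) \<and> lmem (claim (x 1) 0 (cand_value q)) (cand_trace q)"

text \<open>The successors at which an embedding starting with this finite tree has to
  continue.\<close>

definition cand_leaves :: "nat \<Rightarrow> nat set" where
  "cand_leaves q = pos (cand_node q) ` {cand_len q..2 * cand_len q}"

definition xpick :: "(nat \<Rightarrow> nat) \<Rightarrow> nat \<Rightarrow> nat \<Rightarrow> nat" where
  "xpick x s y = pick (cand x) pfst (val x) s y"

text \<open>The acceptance condition with the set of leaves replaced by a bounded quantifier, so
  that decidability can be read off.\<close>

definition xacc :: "(nat \<Rightarrow> nat) \<Rightarrow> nat \<Rightarrow> nat \<Rightarrow> bool" where
  "xacc x s t \<longleftrightarrow> xpick x s (psnd t) \<le> s \<and>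
     (\<forall>j\<le>cand_len (xpick x s (psnd t)) + cand_len (xpick x s (psnd t)).
       cand_len (xpick x s (psnd t)) \<le> j \<longrightarrow>
       (\<exists>z\<le>t. pre (pos (cand_node (xpick x s (psnd t))) j) z \<and> guess (val x) s z = guess (val x) s (psnd t)))"

definition forward :: "(nat \<Rightarrow> nat) \<Rightarrow> nat \<Rightarrow> nat" where
  "forward x s = cand_value (xpick x s (psnd (bleast (xacc x s) (Suc s))))"

lemma rec_comp3:
  assumes "rec_fun (\<lambda>X m. H X (pfst m) (pfst (psnd m)) (psnd (psnd m)))"
    and "rec_fun F" "rec_fun G" "rec_fun K"
  shows "rec_fun (\<lambda>X n. H X (F X n) (G X n) (K X n))"
  using rec_comp[OF assms(1) rec_pair[OF assms(2) rec_pair[OF assms(3,4)]]] by simp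

lemma rec_pred_comp3:
  assumes "rec_pred (\<lambda>X m. H X (pfst m) (pfst (psnd m)) (psnd (psnd m)))"
    and "rec_fun F" "rec_fun G" "rec_fun K"
  shows "rec_pred (\<lambda>X n. H X (F X n) (G X n) (K X n))"
  using rec_comp3[OF assms(1)[unfolded rec_pred_def] assms(2-4)] unfolding rec_pred_def .

lemma rec_val:
  "rec_fun F \<Longrightarrow> rec_fun G \<Longrightarrow> rec_fun K \<Longrightarrow> rec_pred (\<lambda>X n. val X (F X n) (G X n) (K X n))"
proof (rule rec_pred_comp3[where H = "val"])
  have tr: "rec_pred (\<lambda>X n. trace (\<lambda>k. X (k + 2)) (W X n))" if "rec_fun W" for W
    by (rule rec_trace[where Or = "\<lambda>X _ k. X (k + 2)" and C = "\<lambda>_ _. 0"]) (intro rec_intros that)+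
  show "rec_pred (\<lambda>X m. val X (pfst m) (pfst (psnd m)) (psnd (psnd m)))"
    unfolding val_def by (intro rec_intros tr rec_lmem)
qed

lemma rec_pos: "rec_fun Q \<Longrightarrow> rec_fun J \<Longrightarrow> rec_fun (\<lambda>X n. pos (cand_node (Q X n)) (J X n))"
proof (rule rec_comp2[where H = "\<lambda>_ q. pos (cand_node q)"])
  show "rec_fun (\<lambda>X m. pos (cand_node (pfst m)) (psnd m))"
    unfolding pos_def mult_2 even_iff_mod_2_eq_zero by (intro rec_intros rec_lnth) simp_all
qed

lemma rec_cand:
  "rec_fun F \<Longrightarrow> rec_fun G \<Longrightarrow> rec_fun K \<Longrightarrow> rec_pred (\<lambda>X n. cand X (F X n) (G X n) (K X n))"
proof (rule rec_pred_comp3[where H = "cand"])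
  have set: "rec_fun (\<lambda>X n. cand_set (Q X n) (J X n))" if "rec_fun Q" "rec_fun J" for Q J
  proof (rule rec_comp2[where H = "\<lambda>_. cand_set", OF _ that])
    show "rec_fun (\<lambda>X m. cand_set (pfst m) (psnd m))"
      unfolding cand_set_def by (intro rec_intros rec_lnth)
  qed
  have orac: "rec_fun (\<lambda>X m. cand_oracle X (pfst m) (psnd m))"
    unfolding cand_oracle_def join_def even_iff_mod_2_eq_zero
    by (intro rec_intros set) simp_all
  show "rec_pred (\<lambda>X m. cand X (pfst m) (pfst (psnd m)) (psnd (psnd m)))"
    unfolding cand_def
    by (intro rec_intros rec_pre rec_lnth rec_pos rec_val rec_lmem rec_trace[OF orac])
qed

lemma rec_reach:
  "rec_fun F \<Longrightarrow> rec_fun G \<Longrightarrow> rec_fun K \<Longrightarrow> rec_pred (\<lambda>X n. reach (val X) (F X n) (G X n) (K X n))"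
proof (rule rec_pred_comp3[where H = "\<lambda>X. reach (val X)"])
  show "rec_pred (\<lambda>X m. reach (val X) (pfst m) (pfst (psnd m)) (psnd (psnd m)))"
    unfolding reach_def by (intro rec_intros rec_pre rec_val)
qed

lemma rec_guess:
  "rec_fun F \<Longrightarrow> rec_fun G \<Longrightarrow> rec_fun (\<lambda>X n. guess (val X) (F X n) (G X n))"
proof (rule rec_comp2[where H = "\<lambda>X. guess (val X)"])
  have sh: "rec_pred (\<lambda>X n. shrinks (val X) (F X n) (G X n) (K X n))"
    if "rec_fun F" "rec_fun G" "rec_fun K" for F G K
  proof (rule rec_pred_comp3[where H = "\<lambda>X. shrinks (val X)", OF _ that])
    show "rec_pred (\<lambda>X m. shrinks (val X) (pfst m) (pfst (psnd m)) (psnd (psnd m)))"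
      unfolding shrinks_def by (intro rec_intros rec_reach)
  qed
  have cu: "rec_fun (\<lambda>X n. cur (val X) (F X n) (G X n) (K X n))"
    if "rec_fun F" "rec_fun G" "rec_fun K" for F G K
  proof (rule rec_comp3[where H = "\<lambda>X. cur (val X)", OF _ that])
    show "rec_fun (\<lambda>X m. cur (val X) (pfst m) (pfst (psnd m)) (psnd (psnd m)))"
      unfolding cur_def by (intro rec_intros rec_pre sh)
  qed
  show "rec_fun (\<lambda>X m. guess (val X) (pfst m) (psnd m))"
    unfolding guess_def by (intro rec_bleast rec_reach cu rec_intros)
qed

lemma rec_xpick: "rec_fun F \<Longrightarrow> rec_fun G \<Longrightarrow> rec_fun (\<lambda>X n. xpick X (F X n) (G X n))"
proof (rule rec_comp2[where H = "xpick"])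
  show "rec_fun (\<lambda>X m. xpick X (pfst m) (psnd m))"
    unfolding xpick_def pick_def by (intro rec_intros rec_cand rec_guess)
qed

lemma rec_forward: "rec_fun forward"
proof -
  have "rec_pred (\<lambda>X m. xacc X (pfst m) (psnd m))"
    unfolding xacc_def by (intro rec_intros rec_xpick rec_guess rec_pre rec_pos)
  note acc = rec_pred_comp2[where H = xacc, OF this]
  have "rec_fun (\<lambda>X s. forward X s)"
    unfolding forward_def by (intro rec_bleast acc rec_xpick rec_intros)
  then show ?thesis .
qed

section \<open>Correctness of the reported values\<close>

lemma TT1N_solution:
  assumes "\<And>j. 0 < j \<Longrightarrow> pre (pos \<theta> j) (\<theta> j)" "\<And>j. f (\<theta> j) = c"
  shows "char_fun (range \<theta>) \<in> solutions TT1N f"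
proof -
  let ?H = "{s. str_code s \<in> range \<theta>}"
  have "str_code ` ?H = range \<theta>"
    using bij_str_code by (auto simp: bij_def image_iff) (metis surj_def)
  moreover have "iso_full_tree ?H" by (rule iso_full_tree_embedding) (rule assms(1))
  moreover have "\<exists>c. \<forall>s\<in>?H. f (str_code s) = c" using assms(2) by auto
  ultimately have "\<exists>H. char_fun (range \<theta>) = char_fun (str_code ` H) \<and> iso_full_tree H \<and>
      (\<exists>c. \<forall>s\<in>H. f (str_code s) = c)"
    by (intro exI[of _ ?H]) simp
  then show ?thesis unfolding TT1N_def problem.simps mem_Collect_eq .
qed

locale first_order_instance =
  fixes A :: "nat \<Rightarrow> nat" and d e :: nat and f :: "nat \<Rightarrow> nat"
  assumes colouring: "f \<in> instances TT1N" "computes d A f"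
    and converges: "\<And>y. y \<in> solutions TT1N f \<Longrightarrow> Phi e (join A y) 0 \<noteq> None"
begin

abbreviation x where "x \<equiv> triple A d e"

lemma x_simps: "x 0 = d" "x (Suc 0) = e" "(\<lambda>k. x (k + 2)) = A" "(\<lambda>k. x (Suc (Suc k))) = A"
  by (auto simp: triple_def fun_eq_iff)

lemma val_sound: "val x s n c \<Longrightarrow> f n = c"
  using trace_sound[of A _ d n c] colouring(2)
  unfolding val_def x_simps computes_def Phi_def by auto

lemma val_mono: "val x s n c \<Longrightarrow> s \<le> s' \<Longrightarrow> val x s' n c"
  unfolding val_def by (meson order.trans)

lemma val_complete: "\<exists>s. val x s n (f n)"
proof -
  have "certified A (claim d n (f n))"
    using certified_run colouring(2) unfolding computes_def Phi_def by blast
  then show ?thesis unfolding val_def certified_def x_simps by blast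
qed

lemma val_le: "val x s n c \<Longrightarrow> c \<le> s"
  unfolding val_def using lmem_claim_less by fastforce

sublocale approx_colouring f "val x"
proof
  have "range (\<lambda>s. f (str_code s)) = range f"
    using bij_str_code by (metis bij_is_surj image_image)
  then show "finite (range f)" using colouring(1) by (simp add: TT1N_def)
qed (fact val_sound val_complete val_mono val_le)+

text \<open>A somewhere dense colour yields a full solution above \<open>y\<close>, on which the
  second functional converges. Its certificate uses only finitely much of that solution, and this
  part is the candidate.\<close>

lemma cand_exists:
  assumes "sdense f c y"
  shows "\<exists>q. pfst q = c \<and> (\<forall>\<^sub>F s in sequentially. cand x s y q)"
proof -
  obtain \<theta> where \<theta>: "pre y (\<theta> 0)" "\<forall>j>0. pre (pos \<theta> j) (\<theta> j)" "\<forall>j. f (\<theta> j) = c"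
    using sdense_embedding[OF assms] by blast
  let ?y = "char_fun (range \<theta>)"
  have "?y \<in> solutions TT1N f" using \<theta> by (intro TT1N_solution) auto
  then obtain v where "Phi e (join A ?y) 0 = Some v" using converges by blast
  then have "certified (join A ?y) (claim e 0 v)" unfolding Phi_def by (rule certified_run)
  then obtain w where w: "trace (join A ?y) w" "lmem (claim e 0 v) w"
    unfolding certified_def by blast
  \<comment> \<open>By \<open>embedding_ge\<close>, images of nodes beyond \<open>w\<close> exceed
    \<open>w\<close>, so the first \<open>Suc w\<close> images answer every query of the
    certificate.\<close>
  define n where "n = Suc w"
  define q where "q = pair c (pair n (pair (list_encode (map \<theta> [0..<n])) (pair w v)))"
  have q: "pfst q = c" "cand_len q = n" "cand_trace q = w" "cand_value q = v"
    by (simp_all add: q_def)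
  have node: "cand_node q j = \<theta> j" if "j < n" for j
    using that lnth_encode[of j "map \<theta> [0..<n]"] by (simp add: q_def)
  have pos: "pos (cand_node q) j = pos \<theta> j" if "j < n" for j
  proof -
    have "(j - 1) div 2 < n" using that by linarith
    then show ?thesis unfolding pos_def by (simp only: node)
  qed
  have "trace (cand_oracle x q) w"
  proof (rule trace_cong[OF w(1)])
    fix i assume i: "i < w"
    have "(i div 2 \<in> range \<theta>) = (\<exists>j<n. \<theta> j = i div 2)"
    proof
      assume "i div 2 \<in> range \<theta>"
      then obtain j where j: "\<theta> j = i div 2" by (metis imageE)
      have "j \<le> \<theta> j" using \<theta>(2) by (intro embedding_ge) auto
      then have "j < n" using i j unfolding n_def by linarith
      then show "\<exists>j<n. \<theta> j = i div 2" using j by blast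
    qed (metis rangeI)
    moreover have "(\<exists>j<n. cand_node q j = i div 2) = (\<exists>j<n. \<theta> j = i div 2)"
      using node by auto
    ultimately show "join A ?y i = cand_oracle x q i"
      unfolding cand_oracle_def cand_set_def join_def char_fun_def q x_simps by simp
  qed
  moreover have "\<forall>\<^sub>F s in sequentially. \<forall>j\<in>{..<n}. val x s (\<theta> j) c"
  proof (intro eventually_ball_finite ballI)
    fix j
    obtain s0 where "val x s0 (\<theta> j) c" using val_complete \<theta>(3) by metis
    then show "\<forall>\<^sub>F s in sequentially. val x s (\<theta> j) c"
      unfolding eventually_sequentially using val_mono by blast
  qed simp
  then have "\<forall>\<^sub>F s in sequentially. cand x s y q"
  proof eventually_elim
    case (elim s)
    show ?case
      unfolding cand_def q x_simps One_nat_def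
      using elim \<theta> w(2) \<open>trace (cand_oracle x q) w\<close> node pos
      by (auto simp: n_def)
  qed
  then show ?thesis using q(1) by blast
qed

sublocale candidates f "val x" "cand x" pfst cand_leaves
proof
  show "finite (cand_leaves q)" for q by (simp add: cand_leaves_def)
next
  fix s y q z assume q: "cand x s y q" and "z \<in> cand_leaves q"
  have node: "pre y (cand_node q j)" if "j < cand_len q" for j
    using that
  proof (induction j rule: less_induct)
    case (less j)
    show ?case
    proof (cases "j = 0")
      case True
      then show ?thesis using q by (simp add: cand_def)
    next
      case False
      then have "pre y (cand_node q ((j - 1) div 2))" using less by (intro less.IH) linarith+
      moreover have "pre (pos (cand_node q) j) (cand_node q j)"
        using q less.prems False by (simp add: cand_def)
      ultimately show ?thesis using pre_pos[of "cand_node q" j] by (blast intro: pre_trans)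
    qed
  qed
  obtain j where j: "j \<le> 2 * cand_len q" "z = pos (cand_node q) j"
    using \<open>z \<in> _\<close> unfolding cand_leaves_def by auto
  have "0 < cand_len q" using q by (simp add: cand_def)
  then have "(j - 1) div 2 < cand_len q" using j(1) by linarith
  then show "pre y z" unfolding j(2) using node pre_pos[of "cand_node q" j] by (blast intro: pre_trans)
qed (fact cand_exists)

text \<open>The finite tree extends to a full solution whose new nodes all exceed the certificate.
  The same certificate is then valid for that solution, so its value is attained on a genuine
  solution.\<close>

lemma cand_value_solution:
  assumes q: "cand x s y q" and leaves: "\<forall>z\<in>cand_leaves q. sdense f (pfst q) z"
  shows "(\<lambda>_. cand_value q) \<in> solutions (first_order_part TT1N) x"
proof -
  let ?n = "cand_len q" and ?w = "cand_trace q"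
  have "\<exists>\<theta>. (\<forall>j<?n. \<theta> j = cand_node q j) \<and> (\<forall>j>0. pre (pos \<theta> j) (\<theta> j)) \<and>
    (\<forall>j. f (\<theta> j) = pfst q) \<and> (\<forall>j\<ge>?n. ?w < \<theta> j)"
  proof (rule extend_embedding)
    show "f (cand_node q j) = pfst q" if "j < ?n" for j
      using q that val_sound unfolding cand_def by blast
    show "sdense f (pfst q) (pos (cand_node q) j)" if "?n \<le> j" "j \<le> 2 * ?n" for j
      using leaves that unfolding cand_leaves_def by auto
  qed (use q in \<open>auto simp: cand_def\<close>)
  then obtain \<theta> where \<theta>: "\<forall>j<?n. \<theta> j = cand_node q j" "\<forall>j>0. pre (pos \<theta> j) (\<theta> j)"
    "\<forall>j. f (\<theta> j) = pfst q" "\<forall>j\<ge>?n. ?w < \<theta> j"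
    by blast
  let ?y = "char_fun (range \<theta>)"
  have sol: "?y \<in> solutions TT1N f" using \<theta> by (intro TT1N_solution) auto
  have "trace (join A ?y) ?w"
  proof (rule trace_cong[of "cand_oracle x q"])
    show "trace (cand_oracle x q) ?w" using q by (simp add: cand_def)
  next
    fix i assume i: "i < ?w"
    have "(i div 2 \<in> range \<theta>) = (\<exists>j<?n. cand_node q j = i div 2)"
    proof
      assume "i div 2 \<in> range \<theta>"
      then obtain j where j: "\<theta> j = i div 2" by (metis imageE)
      have "j < ?n"
      proof (rule ccontr)
        assume "\<not> j < ?n"
        then have "?w < \<theta> j" using \<theta>(4) by simp
        then show False using i j by linarith
      qed
      then show "\<exists>j<?n. cand_node q j = i div 2" using \<theta>(1) j by auto
    qed (use \<theta>(1) in \<open>metis rangeI\<close>)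
    then show "cand_oracle x q i = join A ?y i"
      unfolding cand_oracle_def cand_set_def join_def char_fun_def x_simps by simp
  qed
  moreover have "lmem (claim e 0 (cand_value q)) ?w"
    using q by (simp add: cand_def x_simps)
  ultimately have "Phi e (join A ?y) 0 = Some (cand_value q)"
    unfolding Phi_def by (rule trace_sound)
  then show ?thesis
    unfolding first_order_part_def using sol colouring(2) by simp blast
qed

lemma xacc_eq: "xacc x s t = acc s t"
  unfolding xacc_def acc_def xpick_def cand_leaves_def mult_2 by auto

lemma forward_eventually:
  "\<exists>B. \<forall>\<^sub>F s in sequentially. forward x s \<le> B \<and>
     (\<lambda>_. forward x s) \<in> solutions (first_order_part TT1N) x"
proof -
  obtain B where B: "\<forall>\<^sub>F s in sequentially. \<exists>y q. y = psnd (bleast (acc s) (Suc s)) \<and> q = pk s y \<and>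
      q \<le> B \<and> cand x s y q \<and> (\<forall>z\<in>cand_leaves q. sdense f (pfst q) z)"
    using selection by blast
  have "\<forall>\<^sub>F s in sequentially. forward x s \<le> B \<and>
     (\<lambda>_. forward x s) \<in> solutions (first_order_part TT1N) x"
    using B
  proof eventually_elim
    case (elim s)
    then obtain y q where y: "y = psnd (bleast (acc s) (Suc s))" and q: "q = pk s y" "q \<le> B"
      "cand x s y q" "\<forall>z\<in>cand_leaves q. sdense f (pfst q) z"
      by blast
    have "xacc x s = acc s" by (rule ext) (rule xacc_eq)
    then have fw: "forward x s = cand_value q"
      unfolding forward_def xpick_def by (simp only: y[symmetric] q(1)[symmetric])
    have psnd: "psnd k \<le> k" for k
      by (metis le_prod_encode_2 prod.collapse prod_decode_inverse)
    \<comment> \<open>The value is a component of the code \<open>q\<close>, so the bound on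
      candidates bounds the values too.\<close>
    have "cand_value q \<le> q" using psnd order.trans by metis
    then show ?case unfolding fw using q(2) cand_value_solution[OF q(3,4)] by simp
  qed
  then show ?thesis by blast
qed

lemma forward_RT1N: "forward x \<in> instances RT1N"
proof -
  obtain B s0 where B: "\<And>s. s \<ge> s0 \<Longrightarrow> forward x s \<le> B"
    using forward_eventually unfolding eventually_sequentially by blast
  have "forward x s \<in> forward x ` {..<s0} \<union> {..B}" for s
    using B[of s] by (cases "s < s0") auto
  then have "range (forward x) \<subseteq> forward x ` {..<s0} \<union> {..B}" by blast
  then have "finite (range (forward x))" by (rule finite_subset) simp
  then show ?thesis by (simp add: RT1N_def)
qed

lemma forward_solution:
  assumes "infinite M" "\<forall>n\<in>M. forward x n = c"
  shows "(\<lambda>_. c) \<in> solutions (first_order_part TT1N) x"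
proof -
  obtain s0 where s0: "\<And>s. s \<ge> s0 \<Longrightarrow> (\<lambda>_. forward x s) \<in> solutions (first_order_part TT1N) x"
    using forward_eventually unfolding eventually_sequentially by blast
  obtain n where "n \<ge> s0" "n \<in> M" using assms(1) finite_nat_set_iff_bounded_le[of M] by (meson nat_le_linear)
  then show ?thesis using s0 assms(2) by auto
qed

end

section \<open>The backward functional and the reduction\<close>

text \<open>A homogeneous set does not display its colour. The backward functional therefore
  searches for the least element of the set and evaluates the forward functional there.\<close>

lemma search_first:
  assumes "rec_fun F"
  shows "\<exists>p. \<forall>X Y n. (\<exists>k. Y k \<noteq> 0) \<longrightarrow>
    (\<exists>k. Y k \<noteq> 0 \<and> run p (join X Y) n = Some (F X k))"
proof -
  \<comment> \<open>The odd entries of the join hold \<open>Y\<close>; the test is inverted because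
    \<open>Min\<close> stops at the value \<open>0\<close>.\<close>
  have "rec_fun (\<lambda>Z m. if Z (psnd m + psnd m + 1) = 0 then 1 else 0)" by (intro rec_intros)
  then obtain p where p: "\<And>Z m. run p Z m = Some (if Z (psnd m + psnd m + 1) = 0 then 1 else 0)"
    unfolding rec_fun_def by blast
  obtain r where r: "\<And>Z n. run r Z n = Some (F (\<lambda>i. Z (2 * i)) n)"
    using rec_fun_join_left[OF assms] unfolding rec_fun_def by blast
  have "\<exists>k. Y k \<noteq> 0 \<and> run (Comp r (Min p)) (join X Y) n = Some (F X k)" if "\<exists>k. Y k \<noteq> 0" for X Y n
  proof -
    have test: "run p (join X Y) (pair n k) = Some 0 \<longleftrightarrow> Y k \<noteq> 0" for k
      by (simp add: p join_def)
    define k where "k = (LEAST k. Y k \<noteq> 0)"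
    have k: "Y k \<noteq> 0" unfolding k_def using that by (rule LeastI_ex)
    have "run (Min p) (join X Y) n = Some k"
      using k by (simp add: test k_def) (auto simp: p)
    moreover have "(\<lambda>i. join X Y (2 * i)) = X" by (auto simp: join_def)
    ultimately show ?thesis using k by (intro exI[of _ k]) (simp add: r)
  qed
  then show ?thesis by blast
qed

theorem theorem5p7:
  shows "first_order_part TT1N \<le>\<^sub>W RT1N"
proof -
  obtain p where "\<And>X n. run p X n = Some (forward X n)"
    using rec_forward unfolding rec_fun_def by blast
  moreover obtain i where "prog_of i = p" using surj_prog_of by (metis surjE)
  ultimately have i: "computes i X (forward X)" for X
    by (simp add: computes_def Phi_def)
  obtain r where r: "\<And>X Y n. (\<exists>k. Y k \<noteq> 0) \<Longrightarrow>
      (\<exists>k. Y k \<noteq> 0 \<and> run r (join X Y) n = Some (forward X k))"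
    using search_first[OF rec_forward] by blast
  obtain j where j: "prog_of j = r" using surj_prog_of by (metis surjE)
  show ?thesis
    unfolding weihrauch_le_def
  proof (intro exI ballI)
    fix x assume "x \<in> instances (first_order_part TT1N)"
    then obtain A d e f where x: "x = triple A d e" and f: "f \<in> instances TT1N" "computes d A f"
      and conv: "\<forall>y\<in>solutions TT1N f. Phi e (join A y) 0 \<noteq> None"
      by (auto simp: first_order_part_def)
    interpret first_order_instance A d e f
      using f conv by unfold_locales blast+
    have "\<exists>w\<in>solutions (first_order_part TT1N) x. computes j (join x y) w"
      if sol: "y \<in> solutions RT1N (forward x)" for y
    proof -
      obtain M c where y: "y = char_fun M" and M: "infinite M" "\<forall>n\<in>M. forward x n = c"
        using sol unfolding RT1N_def by auto
      have mem: "y k \<noteq> 0 \<longleftrightarrow> k \<in> M" for k by (simp add: y char_fun_def)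
      have "\<exists>k. y k \<noteq> 0" using M(1) mem by (metis ex_in_conv finite.emptyI)
      then have "computes j (join x y) (\<lambda>_. c)"
        unfolding computes_def Phi_def j using r[of y x] M(2) mem by metis
      moreover have "(\<lambda>_. c) \<in> solutions (first_order_part TT1N) x"
        using forward_solution[OF M[unfolded x]] unfolding x .
      ultimately show ?thesis by blast
    qed
    then show "\<exists>z\<in>instances RT1N. computes i x z \<and>
        (\<forall>y\<in>solutions RT1N z. \<exists>w\<in>solutions (first_order_part TT1N) x. computes j (join x y) w)"
      using i[of x] forward_RT1N unfolding x by blast
  qed
qed

end
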